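(* Assume, for each $n$, the observation model, the exchangeable exponential moment condition on $\xi$ with constants $\beta\in(0,1]$, $B>0$, and the empirical Bayes construction with prior parameter $\varkappa$ described in the context, and assume $\varkappa>\bar\varkappa:=(12-\beta+4B)/(4\beta)$. Let $(\hat\pi(\vartheta|X),\hat\theta)$ be either $(\tilde\pi(\vartheta|X),\tilde\theta)$ or $(\check\pi(\vartheta|X),\check\theta)$, and $\hat r^2=\sigma^2+\sigma^2|\hat I|\log(en/|\hat I|)$. Let $s\in(0,2)$, let $p_n>0$ satisfy $p_n=o(\sigma n)$ as $n\to\infty$, and let the weak $\ell_s$-ball $m_s[p_n]$ and the rate $r^2(m_s[p_n])$ be as defined in the context. Then there exist positive constants $M_0,H_0,m_0,M_1,H_1,m_1,M_0',H_0'$ depending only on $\beta,B,\varkappa$, and $K=K(s)>0$, such that for all sufficiently large $n$ and any $M\ge0$ $$\sup_{\theta\in m_s[p_n]}\mathrm{E}_\theta\hat\pi\big(\|\vartheta-\theta\|^2\ge M_0K\,r^2(m_s[p_n])+M\sigma^2\,\big|\,X\big)\le H_0e^{-m_0M},$$ $$\sup_{\theta\in m_s[p_n]}\mathrm{P}_\theta\big(\|\hat\theta-\theta\|^2\ge M_1K\,r^2(m_s[p_n])+M\sigma^2\big)\le H_1e^{-m_1M},$$ $$\sup_{\theta\in m_s[p_n]}\mathrm{P}_\theta\big(\hat r^2\ge M_0'K\,r^2(m_s[p_n])+(M+1)\sigma^2\big)\le H_0'e^{-M}.$$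
   Context: Model. $n\in\mathbb{N}$, $[n]=\{1,\dots,n\}$, $\sigma>0$ known (possibly depending on $n$), $\theta\in\mathbb{R}^n$ unknown. One observes $X=(X_1,\dots,X_n)$, $X_i=\theta_i+\sigma\xi_i$, $i\in[n]$, where $\xi=(\xi_1,\dots,\xi_n)$ is a random vector (its distribution is unknown, may depend on $\theta$, and its coordinates need not be independent or normal) with $\mathrm{E}\xi_i=0$, $\mathrm{Var}(\xi_i)\le 1$. $\mathrm{P}_\theta,\mathrm{E}_\theta$ denote the law of $X$ and its expectation. $\|\cdot\|$ is the Euclidean norm. $\beta,B,\varkappa,s$ do not depend on $n$. Exchangeable exponential moment condition with constants $\beta\in(0,1]$, $B>0$: $\mathrm{E}\exp\{\beta\sum_{i\in I}\xi_i^2\}\le e^{B|I|}$ for all $I\subseteq[n]$ (for every $\theta$, if the law of $\xi$ depends on $\theta$). Conventions. $\mathcal{I}$ is the family of all subsets of $[n]$ (including $\varnothing$), $I^c=[n]\setminus I$, $0\log(c/0)=0$ and $(c/0)^0=1$ for $c>0$, $\mathrm{N}(\mu,0)=\delta_\mu$ is the Dirac measure, $\phi(x,\mu,s^2)$ is the $\mathrm{N}(\mu,s^2)$ density at $x$, $X(I)=(X_i\mathbf{1}\{i\in I\})_{i\in[n]}$. Empirical Bayes construction. Fix $\varkappa>1$. Let $\lambda_I=c_{\varkappa,n}(en/|I|)^{-\varkappa|I|}$, $I\in\mathcal{I}$, with $c_{\varkappa,n}$ normalizing so that $\sum_{I}\lambda_I=1$; $K_n(I)=(\frac{en}{|I|}-1)\mathbf{1}\{I\ne\varnothing\}$;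 $\tau_i^2(I)=\sigma^2K_n(I)\mathbf{1}\{i\in I\}$; $\mathrm{P}_{X,I}=\prod_{i=1}^n\phi(X_i,X_i\mathbf{1}\{i\in I\},\sigma^2+\tau_i^2(I))$. Define - $\tilde\pi(I|X)=\lambda_I\mathrm{P}_{X,I}/\sum_{J\in\mathcal{I}}\lambda_J\mathrm{P}_{X,J}$; - $\tilde\pi_I(\vartheta|X)=\bigotimes_{i=1}^n\mathrm{N}\big(X_i\mathbf{1}\{i\in I\},\frac{K_n(I)\sigma^2\mathbf{1}\{i\in I\}}{K_n(I)+1}\big)$, a distribution for $\vartheta\in\mathbb{R}^n$; - $\tilde\pi(\vartheta|X)=\sum_{I}\tilde\pi_I(\vartheta|X)\tilde\pi(I|X)$, with mean $\tilde\theta=\sum_IX(I)\tilde\pi(I|X)$; - $\hat I$ any maximizer of $\tilde\pi(I|X)$ over $I\in\mathcal{I}$, equivalently any minimizer of $\sum_{i\in I^c}X_i^2+(2\varkappa+1)\sigma^2|I|\log(\frac{en}{|I|})$; - $\check\pi(\vartheta|X)=\tilde\pi_{\hat I}(\vartheta|X)$, with mean $\check\theta=X(\hat I)$. Weak $\ell_s$-ball and its rate. With $\theta_{[1]}^2\ge\dots\ge\theta_{[n]}^2$ the ordered values of $\theta_1^2,\dots,\theta_n^2$, $$m_s[p_n]=\big\{\theta\in\mathbb{R}^n:\ \theta_{[i]}^2\le(p_n/n)^2(n/i)^{2/s},\ i\in[n]\big\}.$$ The (minimax) rate over this class is $r^2(m_s[p_n])=n(\frac{p_n}{n})^s\big[\sigma^2\log(\frac{n\sigma}{p_n})\big]^{1-s/2}$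 when $n^{2/s}(\frac{p_n}{n})^2\ge\sigma^2\log n$, and $r^2(m_s[p_n])=n^{2/s}(\frac{p_n}{n})^2+\sigma^2$ when $n^{2/s}(\frac{p_n}{n})^2<\sigma^2\log n$. *)

theory Defs
  imports "HOL-Probability.Probability" "HOL-Library.Landau_Symbols"
begin

text \<open>
  A vector in the \<open>n\<close>-dimensional Euclidean space is an extensional function on \<open>{1..n}\<close>;
  this is the space of the following product \<open>\<sigma>\<close>-algebra.
\<close>

definition Rn :: "nat \<Rightarrow> (nat \<Rightarrow> real) measure" where
  "Rn n = (\<Pi>\<^sub>M i\<in>{1..n}. borel)"

definition sq_dist :: "nat \<Rightarrow> (nat \<Rightarrow> real) \<Rightarrow> (nat \<Rightarrow> real) \<Rightarrow> real" where
  "sq_dist n x y = (L2_set (\<lambda>i. x i - y i) {1..n})\<^sup>2"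


section \<open>Observation model\<close>

definition noise_law :: "nat \<Rightarrow> (nat \<Rightarrow> real) measure \<Rightarrow> bool" where
  "noise_law n Q \<longleftrightarrow>
     prob_space Q \<and> sets Q = sets (Rn n) \<and>
     (\<forall>i\<in>{1..n}.
        integrable Q (\<lambda>\<xi>. \<xi> i) \<and> integrable Q (\<lambda>\<xi>. (\<xi> i)\<^sup>2) \<and>
        prob_space.expectation Q (\<lambda>\<xi>. \<xi> i) = 0 \<and>
        prob_space.variance Q (\<lambda>\<xi>. \<xi> i) \<le> 1)"

text \<open>The expectation is a nonnegative integral, so the bound includes its finiteness.\<close>

definition exch_exp_moment ::
    "real \<Rightarrow> real \<Rightarrow> nat \<Rightarrow> (nat \<Rightarrow> real) measure \<Rightarrow> bool" where
  "exch_exp_moment \<beta> B n Q \<longleftrightarrow>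
     (\<forall>I. I \<subseteq> {1..n} \<longrightarrow>
        (\<integral>\<^sup>+\<xi>. ennreal (exp (\<beta> * (\<Sum>i\<in>I. (\<xi> i)\<^sup>2))) \<partial>Q) \<le> ennreal (exp (B * real (card I))))"

text \<open>Law of \<open>X = \<theta> + \<sigma> \<xi>\<close> when \<open>\<xi>\<close> has law \<open>Q\<close>.\<close>

definition obs_law ::
    "nat \<Rightarrow> real \<Rightarrow> (nat \<Rightarrow> real) measure \<Rightarrow> (nat \<Rightarrow> real) \<Rightarrow> (nat \<Rightarrow> real) measure" where
  "obs_law n \<sigma> Q \<theta> = distr Q (Rn n) (\<lambda>\<xi>. \<lambda>i\<in>{1..n}. \<theta> i + \<sigma> * \<xi> i)"


section \<open>Empirical Bayes posteriors\<close>

text \<open>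
  Parametrized by the variance \<open>v\<close>, with \<open>N(\<mu>, 0)\<close> the Dirac measure; the library's
  \<^const>\<open>normal_density\<close> takes the standard deviation.
\<close>

definition normal_law :: "real \<Rightarrow> real \<Rightarrow> real measure" where
  "normal_law \<mu> v =
     (if v = 0 then return borel \<mu>
      else density lborel (\<lambda>x. ennreal (normal_density \<mu> (sqrt v) x)))"

text \<open>The empty set is treated separately because \<open>0 powr 0 = 0\<close>, whereas \<open>(c/0)\<^sup>0\<close> is to be 1.\<close>

definition prior_weight :: "real \<Rightarrow> nat \<Rightarrow> nat set \<Rightarrow> real" where
  "prior_weight \<kappa> n I =
     (if I = {} then 1
      else (exp 1 * real n / real (card I)) powr (- \<kappa> * real (card I)))"

definition prior :: "real \<Rightarrow> nat \<Rightarrow> nat set \<Rightarrow> real" where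
  "prior \<kappa> n I = prior_weight \<kappa> n I / (\<Sum>J\<in>Pow {1..n}. prior_weight \<kappa> n J)"

definition Kn :: "nat \<Rightarrow> nat set \<Rightarrow> real" where
  "Kn n I = (if I = {} then 0 else exp 1 * real n / real (card I) - 1)"

definition marginal :: "nat \<Rightarrow> real \<Rightarrow> (nat \<Rightarrow> real) \<Rightarrow> nat set \<Rightarrow> real" where
  "marginal n \<sigma> x I =
     (\<Prod>i\<in>{1..n}. normal_density (x i * indicator I i)
                      (sqrt (\<sigma>\<^sup>2 + \<sigma>\<^sup>2 * Kn n I * indicator I i)) (x i))"

definition post_set :: "real \<Rightarrow> nat \<Rightarrow> real \<Rightarrow> (nat \<Rightarrow> real) \<Rightarrow> nat set \<Rightarrow> real" where
  "post_set \<kappa> n \<sigma> x I =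
     prior \<kappa> n I * marginal n \<sigma> x I / (\<Sum>J\<in>Pow {1..n}. prior \<kappa> n J * marginal n \<sigma> x J)"

definition post_given :: "nat \<Rightarrow> real \<Rightarrow> (nat \<Rightarrow> real) \<Rightarrow> nat set \<Rightarrow> (nat \<Rightarrow> real) measure" where
  "post_given n \<sigma> x I =
     (\<Pi>\<^sub>M i\<in>{1..n}. normal_law (x i * indicator I i)
                        (Kn n I * \<sigma>\<^sup>2 * indicator I i / (Kn n I + 1)))"

definition post_mix :: "real \<Rightarrow> nat \<Rightarrow> real \<Rightarrow> (nat \<Rightarrow> real) \<Rightarrow> (nat \<Rightarrow> real) measure" where
  "post_mix \<kappa> n \<sigma> x =
     point_measure (Pow {1..n}) (\<lambda>I. ennreal (post_set \<kappa> n \<sigma> x I)) \<bind> post_given n \<sigma> x"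

definition proj :: "nat \<Rightarrow> (nat \<Rightarrow> real) \<Rightarrow> nat set \<Rightarrow> (nat \<Rightarrow> real)" where
  "proj n x I = (\<lambda>i\<in>{1..n}. x i * indicator I i)"

definition mean_mix :: "real \<Rightarrow> nat \<Rightarrow> real \<Rightarrow> (nat \<Rightarrow> real) \<Rightarrow> (nat \<Rightarrow> real)" where
  "mean_mix \<kappa> n \<sigma> x =
     (\<lambda>i\<in>{1..n}. \<Sum>I\<in>Pow {1..n}. proj n x I i * post_set \<kappa> n \<sigma> x I)"

text \<open>
  \<open>Ihat\<close> is an arbitrary measurable choice of a maximizer; the maximizer need not be unique.
\<close>

definition max_selector ::
    "real \<Rightarrow> nat \<Rightarrow> real \<Rightarrow> ((nat \<Rightarrow> real) \<Rightarrow> nat set) \<Rightarrow> bool" where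
  "max_selector \<kappa> n \<sigma> Ihat \<longleftrightarrow>
     Ihat \<in> Rn n \<rightarrow>\<^sub>M count_space (Pow {1..n}) \<and>
     (\<forall>x\<in>space (Rn n). is_arg_max (post_set \<kappa> n \<sigma> x) (\<lambda>I. I \<in> Pow {1..n}) (Ihat x))"

datatype eb_kind = Averaging | Selection

fun eb_posterior ::
    "eb_kind \<Rightarrow> real \<Rightarrow> nat \<Rightarrow> real \<Rightarrow> ((nat \<Rightarrow> real) \<Rightarrow> nat set) \<Rightarrow>
     (nat \<Rightarrow> real) \<Rightarrow> (nat \<Rightarrow> real) measure" where
  "eb_posterior Averaging \<kappa> n \<sigma> Ihat x = post_mix \<kappa> n \<sigma> x"
| "eb_posterior Selection \<kappa> n \<sigma> Ihat x = post_given n \<sigma> x (Ihat x)"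

fun eb_estimator ::
    "eb_kind \<Rightarrow> real \<Rightarrow> nat \<Rightarrow> real \<Rightarrow> ((nat \<Rightarrow> real) \<Rightarrow> nat set) \<Rightarrow>
     (nat \<Rightarrow> real) \<Rightarrow> (nat \<Rightarrow> real)" where
  "eb_estimator Averaging \<kappa> n \<sigma> Ihat x = mean_mix \<kappa> n \<sigma> x"
| "eb_estimator Selection \<kappa> n \<sigma> Ihat x = proj n x (Ihat x)"

text \<open>At \<open>I = {}\<close> the second summand is 0, as required, since its factor \<open>card I\<close> is.\<close>

definition eb_radius_sq :: "nat \<Rightarrow> real \<Rightarrow> nat set \<Rightarrow> real" where
  "eb_radius_sq n \<sigma> I =
     \<sigma>\<^sup>2 + \<sigma>\<^sup>2 * real (card I) * ln (exp 1 * real n / real (card I))"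


section \<open>Weak balls and their rates\<close>

text \<open>The \<open>i\<close>-th largest (\<open>1 \<le> i \<le> n\<close>) of the numbers \<open>(\<theta> 1)\<^sup>2, \<dots>, (\<theta> n)\<^sup>2\<close>, with multiplicity.\<close>

definition ordered_sq :: "nat \<Rightarrow> (nat \<Rightarrow> real) \<Rightarrow> nat \<Rightarrow> real" where
  "ordered_sq n \<theta> i = rev (sort (map (\<lambda>j. (\<theta> j)\<^sup>2) [1..<n+1])) ! (i - 1)"

definition weak_ball :: "real \<Rightarrow> nat \<Rightarrow> real \<Rightarrow> (nat \<Rightarrow> real) set" where
  "weak_ball s n p =
     {\<theta> \<in> space (Rn n). \<forall>i\<in>{1..n}.
        ordered_sq n \<theta> i \<le> (p / real n)\<^sup>2 * (real n / real i) powr (2 / s)}"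

definition weak_rate_sq :: "real \<Rightarrow> nat \<Rightarrow> real \<Rightarrow> real \<Rightarrow> real" where
  "weak_rate_sq s n \<sigma> p =
     (if real n powr (2 / s) * (p / real n)\<^sup>2 \<ge> \<sigma>\<^sup>2 * ln (real n)
      then real n * (p / real n) powr s * (\<sigma>\<^sup>2 * ln (real n * \<sigma> / p)) powr (1 - s / 2)
      else real n powr (2 / s) * (p / real n)\<^sup>2 + \<sigma>\<^sup>2)"

end

theory Submission
  imports Defs
begin

text \<open>
  The posterior weight of a support set \<open>I\<close> is proportional to
  \<open>exp (- (\<kappa> + 1/2) \<rho>(I) - \<Sum>\<^bsub>i \<notin> I\<^esub> X\<^sub>i\<^sup>2 / (2 \<sigma>\<^sup>2))\<close> with \<open>\<rho>(I) = |I| ln (e n / |I|)\<close>. Hence, for every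
  reference set \<open>J\<close> and every \<open>h \<in> [0, 1]\<close>, it is at most the \<open>h\<close>-th power of its ratio to the weight
  of \<open>J\<close>, and so is the indicator of \<open>Ihat = I\<close>; this treats averaging and selection alike. For \<open>h\<close>
  slightly below \<open>\<beta>\<close> the exponential moment condition bounds the expectation of this power, even
  after multiplication by a small exponential of the squared error committed with \<open>I\<close>, by
  \<open>exp (- 2 \<rho>(I) + D (\<rho>(J) + \<Sum>\<^bsub>i \<notin> J\<^esub> \<theta>\<^sub>i\<^sup>2 / \<sigma>\<^sup>2))\<close>, which is summable over \<open>I\<close> because there are at
  most \<open>exp (\<rho>(I))\<close> sets of the size of \<open>I\<close>. All three claims follow by the exponential Markov
  inequality, for arbitrary \<open>J\<close>. On the weak ball, the set \<open>J\<close> of the \<open>k\<close> largest coordinates with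
  \<open>k\<close> about \<open>n \<eta> powr s * ln (1/\<eta>) powr (- s/2)\<close>, where \<open>\<eta> = p / (\<sigma> n)\<close>, or the empty set, has the
  required cost.
\<close>

section \<open>Posterior weights\<close>

definition sparsity_cost :: "nat \<Rightarrow> nat set \<Rightarrow> real" where
  "sparsity_cost n I = real (card I) * ln (exp 1 * real n / real (card I))"

lemma card_le_sparsity_cost:
  assumes "I \<subseteq> {1..n}"
  shows "real (card I) \<le> sparsity_cost n I"
proof (cases "I = {}")
  case False
  have fin: "finite I" using assms finite_subset by blast
  then have pos: "card I > 0" using False by (simp add: card_gt_0_iff)
  have "card I \<le> n" using card_mono[OF _ assms] by simp
  then have "exp 1 \<le> exp 1 * real n / real (card I)"
    using pos by (simp add: field_simps)
  then have "ln (exp 1) \<le> ln (exp 1 * real n / real (card I))"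
    using pos by (subst ln_le_cancel_iff) (auto intro: less_le_trans[OF exp_gt_zero])
  then show ?thesis
    unfolding sparsity_cost_def by (simp add: mult_le_cancel_left1)
qed (simp add: sparsity_cost_def)

lemma sparsity_cost_nonneg: "I \<subseteq> {1..n} \<Longrightarrow> 0 \<le> sparsity_cost n I"
  using card_le_sparsity_cost[of I n] by linarith

text \<open>\<open>k ^ k / fact k\<close> is a single term of the exponential series at
  \<open>k\<close>.\<close>

lemma power_le_fact_exp: "real k ^ k \<le> fact k * exp (real k)"
proof -
  have "real k ^ k / fact k \<le> exp (real k)"
    using sum_le_suminf[OF summable_exp_generic[of "real k"], of "{k}"]
    by (simp add: exp_def field_simps)
  then show ?thesis by (simp add: field_simps)
qed

text \<open>With \<open>k = card I\<close>, the binomial coefficient is at most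
  \<open>n ^ k / fact k\<close>, hence at most \<open>(e n / k) ^ k\<close>, whose logarithm is the
  sparsity cost.\<close>

lemma binomial_le_exp_sparsity_cost:
  assumes "I \<subseteq> {1..n}"
  shows "real (n choose card I) \<le> exp (sparsity_cost n I)"
proof (cases "I = {}")
  case False
  define k where "k = card I"
  have fin: "finite I" using assms finite_subset by blast
  then have pos: "k > 0" using False by (simp add: card_gt_0_iff k_def)
  have kn: "k \<le> n" using card_mono[OF _ assms] by (simp add: k_def)
  have "(n choose k) * fact k \<le> n ^ k"
    by (metis binomial_fact_pow mult.commute)
  then have "real (n choose k) * fact k \<le> real n ^ k"
    by (metis of_nat_fact of_nat_le_iff of_nat_mult of_nat_power)
  then have "real (n choose k) \<le> real n ^ k / fact k"
    by (simp add: field_simps)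
  also have "\<dots> \<le> real n ^ k * exp (real k) / real k ^ k"
    using mult_left_mono[OF power_le_fact_exp[of k], of "real n ^ k"] pos
    by (simp add: field_simps)
  also have "\<dots> = (exp 1 * real n / real k) ^ k"
    by (simp add: power_mult_distrib power_divide exp_of_nat_mult[symmetric] mult.commute)
  also have "\<dots> = exp (sparsity_cost n I)"
    using pos kn by (simp add: sparsity_cost_def k_def[symmetric] exp_of_nat_mult)
  finally show ?thesis by (simp add: k_def)
qed (simp add: sparsity_cost_def)

text \<open>Sets are grouped by size \<open>k\<close>. One factor
  \<open>exp (- sparsity_cost n I)\<close> pays for the number of sets of that size, the other is at
  most \<open>exp (- k)\<close>, and a geometric series with ratio at most 1/2 remains.\<close>

lemma sum_exp_sparsity_cost:
  "(\<Sum>I\<in>Pow {1..n}. exp (- 2 * sparsity_cost n I)) \<le> 2"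
proof -
  have "(\<Sum>I\<in>Pow {1..n}. exp (- 2 * sparsity_cost n I))
      = (\<Sum>k\<in>{..n}. \<Sum>I\<in>{I\<in>Pow {1..n}. card I = k}. exp (- 2 * sparsity_cost n I))"
    by (rule sum.group[symmetric]) (auto intro: card_mono[of "{1..n}", simplified])
  also have "\<dots> \<le> (\<Sum>k\<in>{..n}. exp (- 1) ^ k)"
  proof (rule sum_mono)
    fix k assume "k \<in> {..n}"
    have "(\<Sum>I\<in>{I\<in>Pow {1..n}. card I = k}. exp (- 2 * sparsity_cost n I))
       \<le> of_nat (card {I\<in>Pow {1..n}. card I = k}) * (exp (- 1) ^ k / real (n choose k))"
    proof (rule sum_bounded_above)
      fix I assume I: "I \<in> {I\<in>Pow {1..n}. card I = k}"
      then have "real (n choose k) \<le> exp (sparsity_cost n I)" 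
        using binomial_le_exp_sparsity_cost by auto
      moreover have "exp (- sparsity_cost n I) \<le> exp (- 1) ^ k"
        using I card_le_sparsity_cost[of I n] by (auto simp: exp_of_nat_mult[symmetric])
      moreover have "real (n choose k) > 0" using \<open>k \<in> {..n}\<close> by simp
      ultimately have "exp (- sparsity_cost n I) * real (n choose k)
          \<le> exp (- 1) ^ k * exp (sparsity_cost n I)"
        by (intro mult_mono) auto
      then have "exp (- sparsity_cost n I) * (exp (- sparsity_cost n I) * real (n choose k))
          \<le> exp (- sparsity_cost n I) * (exp (- 1) ^ k * exp (sparsity_cost n I))"
        by (rule mult_left_mono) simp
      then have "exp (- 2 * sparsity_cost n I) * real (n choose k) \<le> exp (- 1) ^ k"
        by (simp add: mult_exp_exp mult.assoc[symmetric] mult.commute[of _ "exp (sparsity_cost n I)"])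
      then show "exp (- 2 * sparsity_cost n I) \<le> exp (- 1) ^ k / real (n choose k)"
        using \<open>real (n choose k) > 0\<close> by (simp add: field_simps)
    qed
    also have "card {I\<in>Pow {1..n}. card I = k} = (n choose k)"
      using n_subsets[of "{1..n}" k] by simp
    finally show "(\<Sum>I\<in>{I\<in>Pow {1..n}. card I = k}. exp (- 2 * sparsity_cost n I)) \<le> exp (- 1) ^ k"
      using \<open>k \<in> {..n}\<close> by simp
  qed
  also have "\<dots> \<le> (\<Sum>k\<in>{..n}. (1 / 2) ^ k)"
  proof (intro sum_mono power_mono)
    have "(2::real) \<le> exp 1" using exp_ge_add_one_self[of 1] by simp
    then show "exp (- 1 :: real) \<le> 1 / 2" by (simp add: exp_minus field_simps)
  qed simp
  also have "\<dots> \<le> 2"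
    by (simp add: sum_gp0)
  finally show ?thesis .
qed

section \<open>Explicit weights, common to averaging and selection\<close>

text \<open>The log posterior weight up to a term independent of \<open>I\<close>;
  \<open>- 2 * \<sigma>^2 * score\<close> is the penalized least squares criterion that the selected
  set minimizes. In \<open>\<kappa> + 1/2\<close>, the \<open>\<kappa>\<close> comes from the prior
  and the 1/2 from the marginal.\<close>

definition score :: "real \<Rightarrow> nat \<Rightarrow> real \<Rightarrow> (nat \<Rightarrow> real) \<Rightarrow> nat set \<Rightarrow> real" where
  "score \<kappa> n \<sigma> x I =
     - (\<kappa> + 1 / 2) * sparsity_cost n I - (\<Sum>i\<in>{1..n} - I. (x i)\<^sup>2) / (2 * \<sigma>\<^sup>2)"

lemma prior_weight_eq:
  assumes "I \<subseteq> {1..n}"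
  shows "prior_weight \<kappa> n I = exp (- \<kappa> * sparsity_cost n I)"
proof (cases "I = {}")
  case False
  have "finite I" using assms finite_subset by blast
  with False have "card I > 0" by (simp add: card_gt_0_iff)
  moreover have "n > 0" using False assms by force
  ultimately show ?thesis
    using False by (simp add: prior_weight_def powr_def sparsity_cost_def)
qed (simp add: prior_weight_def sparsity_cost_def)

text \<open>On \<open>I\<close> each density is evaluated at its own mean, so only the normalization
  is left: the variance is inflated by \<open>1 + Kn n I = e n / |I|\<close>, which contributes the
  inverse square root of that factor. Off \<open>I\<close> the density is that of
  \<open>N(0, \<sigma>^2)\<close>.\<close>

lemma marginal_eq:
  assumes I: "I \<subseteq> {1..n}" and \<sigma>: "\<sigma> > 0"
  shows "marginal n \<sigma> x I = (1 / sqrt (2 * pi * \<sigma>\<^sup>2)) ^ n *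
     exp (- sparsity_cost n I / 2 - (\<Sum>i\<in>{1..n} - I. (x i)\<^sup>2) / (2 * \<sigma>\<^sup>2))"
proof -
  have finI: "finite I" using I finite_subset by blast
  define l where "l = ln (exp 1 * real n / real (card I))"
  have "normal_density (x i * indicator I i) (sqrt (\<sigma>\<^sup>2 + \<sigma>\<^sup>2 * Kn n I * indicator I i)) (x i)
      = (1 / sqrt (2 * pi * \<sigma>\<^sup>2)) *
        exp (if i \<in> I then - l / 2 else - (x i)\<^sup>2 / (2 * \<sigma>\<^sup>2))" (is "?L = ?R")
    if i: "i \<in> {1..n}" for i
  proof (cases "i \<in> I")
    case True
    then have card: "card I > 0" using finI card_gt_0_iff by blast
    have n: "n > 0" using i by simp
    have *: "\<sigma>\<^sup>2 + \<sigma>\<^sup>2 * Kn n I = \<sigma>\<^sup>2 * exp l"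
      using True card n by (auto simp: Kn_def l_def algebra_simps)
    have "sqrt (exp l) = exp (l / 2)"
      by (rule real_sqrt_unique) (simp_all flip: exp_double)
    with * True \<sigma> show ?thesis
      by (simp add: normal_density_def real_sqrt_mult exp_minus field_simps)
  next
    case False
    then show ?thesis using \<sigma> by (simp add: normal_density_def)
  qed
  then have "marginal n \<sigma> x I = (\<Prod>i\<in>{1..n}. (1 / sqrt (2 * pi * \<sigma>\<^sup>2)) *
        exp (if i \<in> I then - l / 2 else - (x i)\<^sup>2 / (2 * \<sigma>\<^sup>2)))"
    unfolding marginal_def by (rule prod.cong[OF refl])
  also have "\<dots> = (1 / sqrt (2 * pi * \<sigma>\<^sup>2)) ^ n *
     exp (\<Sum>i\<in>{1..n}. if i \<in> I then - l / 2 else - (x i)\<^sup>2 / (2 * \<sigma>\<^sup>2))"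
    by (subst prod.distrib) (simp add: exp_sum)
  also have "(\<Sum>i\<in>{1..n}. if i \<in> I then - l / 2 else - (x i)\<^sup>2 / (2 * \<sigma>\<^sup>2))
      = (\<Sum>i\<in>I. - l / 2) + (\<Sum>i\<in>{1..n} - I. - (x i)\<^sup>2 / (2 * \<sigma>\<^sup>2))"
    using I by (subst sum.If_cases) (auto simp: Int_absorb1 Diff_eq)
  also have "\<dots> = - sparsity_cost n I / 2 - (\<Sum>i\<in>{1..n} - I. (x i)\<^sup>2) / (2 * \<sigma>\<^sup>2)"
    by (simp add: sparsity_cost_def l_def sum_negf sum_divide_distrib)
  finally show ?thesis .
qed

lemma post_set_eq:
  assumes I: "I \<subseteq> {1..n}" and \<sigma>: "\<sigma> > 0"
  shows "post_set \<kappa> n \<sigma> x I =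
    exp (score \<kappa> n \<sigma> x I) / (\<Sum>J\<in>Pow {1..n}. exp (score \<kappa> n \<sigma> x J))"
proof -
  \<comment> \<open>The factor shared by all sets; it cancels in the posterior ratio.\<close>
  define c where "c = (1 / sqrt (2 * pi * \<sigma>\<^sup>2)) ^ n / (\<Sum>J\<in>Pow {1..n}. prior_weight \<kappa> n J)"
  have "(\<Sum>J\<in>Pow {1..n}. prior_weight \<kappa> n J) > 0"
    by (rule sum_pos) (auto simp: prior_weight_eq)
  then have c: "c > 0" using \<sigma> by (auto simp: c_def)
  have eq: "prior \<kappa> n J * marginal n \<sigma> x J = c * exp (score \<kappa> n \<sigma> x J)" if "J \<subseteq> {1..n}" for J
    using that by (simp add: prior_def prior_weight_eq marginal_eq[OF that \<sigma>] c_def score_def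
        mult_exp_exp algebra_simps)
  have "(\<Sum>J\<in>Pow {1..n}. prior \<kappa> n J * marginal n \<sigma> x J)
      = c * (\<Sum>J\<in>Pow {1..n}. exp (score \<kappa> n \<sigma> x J))"
    unfolding sum_distrib_left by (rule sum.cong) (auto simp: eq)
  then show ?thesis
    using c eq[OF I] by (simp add: post_set_def)
qed

text \<open>Selection is written as a mixture over supports too, with a point mass at the selected
  set, so that later bounds need no distinction between the two procedures.\<close>

definition eb_weight ::
    "eb_kind \<Rightarrow> real \<Rightarrow> nat \<Rightarrow> real \<Rightarrow> ((nat \<Rightarrow> real) \<Rightarrow> nat set) \<Rightarrow> (nat \<Rightarrow> real) \<Rightarrow> nat set \<Rightarrow> real"
  where
  "eb_weight kind \<kappa> n \<sigma> Ihat x I =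
     (case kind of Averaging \<Rightarrow> post_set \<kappa> n \<sigma> x I | Selection \<Rightarrow> of_bool (Ihat x = I))"

lemma max_selectorD:
  assumes "max_selector \<kappa> n \<sigma> Ihat" "x \<in> space (Rn n)"
  shows "Ihat x \<subseteq> {1..n}"
    and "J \<subseteq> {1..n} \<Longrightarrow> post_set \<kappa> n \<sigma> x J \<le> post_set \<kappa> n \<sigma> x (Ihat x)"
  using assms unfolding max_selector_def is_arg_max_linorder by auto

lemma eb_weight_nonneg:
  assumes "I \<subseteq> {1..n}" "\<sigma> > 0"
  shows "0 \<le> eb_weight kind \<kappa> n \<sigma> Ihat x I"
  by (cases kind) (auto simp: eb_weight_def post_set_eq[OF assms] intro!: divide_nonneg_nonneg sum_nonneg)

lemma sum_eb_weight:
  assumes "\<sigma> > 0" "max_selector \<kappa> n \<sigma> Ihat" "x \<in> space (Rn n)"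
  shows "(\<Sum>I\<in>Pow {1..n}. eb_weight kind \<kappa> n \<sigma> Ihat x I) = 1"
proof (cases kind)
  case Averaging
  have "(\<Sum>J\<in>Pow {1..n}. exp (score \<kappa> n \<sigma> x J)) > 0" by (rule sum_pos) auto
  then have "(\<Sum>I\<in>Pow {1..n}. exp (score \<kappa> n \<sigma> x I) /
      (\<Sum>J\<in>Pow {1..n}. exp (score \<kappa> n \<sigma> x J))) = 1"
    by (simp flip: sum_divide_distrib)
  then show ?thesis
    using Averaging assms(1) by (simp add: eb_weight_def post_set_eq)
next
  case Selection
  have "(\<Sum>I\<in>Pow {1..n}. of_bool (Ihat x = I) :: real) = (\<Sum>I\<in>{Ihat x}. 1)"
    using max_selectorD(1)[OF assms(2,3)]
    by (intro sum.mono_neutral_cong_right) auto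
  then show ?thesis using Selection by (simp add: eb_weight_def)
qed

text \<open>The weight is at most 1 and at most \<open>exp d\<close>, where \<open>d\<close> is the
  score difference. The minimum of these is at most \<open>exp (h * d)\<close>: for
  \<open>d \<ge> 0\<close> because this is at least 1, for \<open>d < 0\<close> because
  \<open>d \<le> h * d\<close>.\<close>

lemma eb_weight_le:
  assumes \<sigma>: "\<sigma> > 0" and sel: "max_selector \<kappa> n \<sigma> Ihat" and x: "x \<in> space (Rn n)"
    and I: "I \<subseteq> {1..n}" and J: "J \<subseteq> {1..n}" and h: "0 \<le> h" "h \<le> 1"
  shows "eb_weight kind \<kappa> n \<sigma> Ihat x I \<le> exp (h * (score \<kappa> n \<sigma> x I - score \<kappa> n \<sigma> x J))"
proof -
  define d where "d = score \<kappa> n \<sigma> x I - score \<kappa> n \<sigma> x J"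
  define S where "S = (\<Sum>J\<in>Pow {1..n}. exp (score \<kappa> n \<sigma> x J))"
  have S: "S > 0" unfolding S_def by (rule sum_pos) auto
  have le_S: "exp (score \<kappa> n \<sigma> x L) \<le> S" if "L \<subseteq> {1..n}" for L
    unfolding S_def using that by (intro member_le_sum) auto
  have min: "eb_weight kind \<kappa> n \<sigma> Ihat x I \<le> 1 \<and> eb_weight kind \<kappa> n \<sigma> Ihat x I \<le> exp d"
  proof (cases kind)
    case Averaging
    have "exp (score \<kappa> n \<sigma> x I) / S \<le> exp (score \<kappa> n \<sigma> x I) / exp (score \<kappa> n \<sigma> x J)"
      using le_S[OF J] S by (intro divide_left_mono) auto
    then show ?thesis
      using Averaging le_S[OF I] S
      by (simp add: eb_weight_def post_set_eq[OF I \<sigma>] S_def d_def exp_diff)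
  next
    case Selection
    \<comment> \<open>A selected set has maximal score, so its indicator is at most
      \<open>1 \<le> exp d\<close>.\<close>
    have "0 \<le> d" if "Ihat x = I"
      using max_selectorD(2)[OF sel x J] S that
      by (simp add: post_set_eq[OF I \<sigma>] post_set_eq[OF J \<sigma>] S_def d_def divide_le_cancel
          less_le)
    then show ?thesis using Selection by (auto simp: eb_weight_def)
  qed
  have "min 1 (exp d) \<le> exp (h * d)"
  proof (cases "d \<ge> 0")
    case False
    then have "d \<le> h * d" using h by (simp add: mult_le_cancel_right1)
    then show ?thesis by (simp add: min.coboundedI2)
  qed (use h in \<open>simp add: min.coboundedI1\<close>)
  with min show ?thesis unfolding d_def by linarith
qed

text \<open>Used with \<open>t = \<theta> / \<sigma>\<close>: the squared error, in units of
  \<open>\<sigma>^2\<close>, of estimating the coordinates outside \<open>I\<close> by zero.\<close>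

definition sq_bias :: "nat \<Rightarrow> (nat \<Rightarrow> real) \<Rightarrow> nat set \<Rightarrow> real" where
  "sq_bias n t I = (\<Sum>i\<in>{1..n} - I. (t i)\<^sup>2)"

lemma sq_bias_nonneg: "0 \<le> sq_bias n t I"
  unfolding sq_bias_def by (rule sum_nonneg) simp

text \<open>Coordinates outside both sets cancel. On \<open>I - J\<close> the bound
  \<open>(t + z)^2 / 2 \<le> t^2 + z^2\<close> is used, on \<open>J - I\<close> the bound
  \<open>(t + z)^2 / 2 \<ge> t^2 / 4 - z^2 / 2\<close>, which rests on
  \<open>(t + 2 z)^2 \<ge> 0\<close>. The signal sums are then rewritten through the two
  biases.\<close>

lemma score_diff_le:
  assumes \<sigma>: "\<sigma> > 0" and I: "I \<subseteq> {1..n}" and J: "J \<subseteq> {1..n}"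
    and x: "\<And>i. i \<in> {1..n} \<Longrightarrow> x i = \<sigma> * (t i + z i)"
  shows "score \<kappa> n \<sigma> x I - score \<kappa> n \<sigma> x J \<le>
     (\<kappa> + 1 / 2) * (sparsity_cost n J - sparsity_cost n I)
     + 5 / 4 * sq_bias n t J - sq_bias n t I / 4 + (\<Sum>i\<in>I \<union> J. (z i)\<^sup>2)"
proof -
  have [simp]: "finite I" "finite J" using I J finite_subset by blast+
  have norm: "(\<Sum>i\<in>{1..n} - L. (x i)\<^sup>2) / (2 * \<sigma>\<^sup>2) = (\<Sum>i\<in>{1..n} - L. (t i + z i)\<^sup>2 / 2)" for L
    using \<sigma> unfolding sum_divide_distrib
    by (intro sum.cong) (auto simp: x power_mult_distrib)
  have split: "(\<Sum>i\<in>{1..n} - A. f i) = (\<Sum>i\<in>{1..n} - (I \<union> J). f i) + (\<Sum>i\<in>B - A. f i)"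
    if "A = I \<and> B = J \<or> A = J \<and> B = I" for A B and f :: "nat \<Rightarrow> real"
    using that I J by (subst sum.union_disjoint[symmetric]) (auto intro!: sum.cong)
  have eqn: "(\<Sum>i\<in>{1..n} - J. (t i + z i)\<^sup>2 / 2) - (\<Sum>i\<in>{1..n} - I. (t i + z i)\<^sup>2 / 2)
      = (\<Sum>i\<in>I - J. (t i + z i)\<^sup>2 / 2) - (\<Sum>i\<in>J - I. (t i + z i)\<^sup>2 / 2)"
    using split[of I J] split[of J I] by simp
  have "(t i + z i)\<^sup>2 / 2 \<le> (t i)\<^sup>2 + (z i)\<^sup>2" for i
    using zero_le_power2[of "t i - z i"] unfolding power2_diff power2_sum by (simp add: field_simps)
  then have up: "(\<Sum>i\<in>I - J. (t i + z i)\<^sup>2 / 2) \<le> (\<Sum>i\<in>I - J. (t i)\<^sup>2) + (\<Sum>i\<in>I - J. (z i)\<^sup>2)"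
    by (simp add: sum.distrib[symmetric] sum_mono)
  have "(t i)\<^sup>2 / 4 - (z i)\<^sup>2 / 2 \<le> (t i + z i)\<^sup>2 / 2" for i
    using zero_le_power2[of "t i + 2 * z i"] unfolding power2_sum by (simp add: field_simps power2_eq_square)
  then have "(\<Sum>i\<in>J - I. (t i)\<^sup>2 / 4 - (z i)\<^sup>2 / 2) \<le> (\<Sum>i\<in>J - I. (t i + z i)\<^sup>2 / 2)"
    by (rule sum_mono)
  then have lo: "(\<Sum>i\<in>J - I. (t i)\<^sup>2) / 4 - (\<Sum>i\<in>J - I. (z i)\<^sup>2) / 2
      \<le> (\<Sum>i\<in>J - I. (t i + z i)\<^sup>2 / 2)"
    by (simp add: sum_subtractf sum_divide_distrib)
  have z_nonneg: "0 \<le> (\<Sum>i\<in>A. (z i)\<^sup>2)" for A by (rule sum_nonneg) simp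
  have t_nonneg: "0 \<le> (\<Sum>i\<in>A. (t i)\<^sup>2)" for A by (rule sum_nonneg) simp
  have "(\<Sum>i\<in>I - J. (z i)\<^sup>2) + (\<Sum>i\<in>J - I. (z i)\<^sup>2) = (\<Sum>i\<in>(I - J) \<union> (J - I). (z i)\<^sup>2)"
    by (rule sum.union_disjoint[symmetric]) auto
  also have "\<dots> \<le> (\<Sum>i\<in>I \<union> J. (z i)\<^sup>2)"
    by (rule sum_mono2) auto
  finally have noise: "(\<Sum>i\<in>I - J. (z i)\<^sup>2) + (\<Sum>i\<in>J - I. (z i)\<^sup>2) \<le> (\<Sum>i\<in>I \<union> J. (z i)\<^sup>2)" .
  have bias: "sq_bias n t I = (\<Sum>i\<in>{1..n} - (I \<union> J). (t i)\<^sup>2) + (\<Sum>i\<in>J - I. (t i)\<^sup>2)"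
      "sq_bias n t J = (\<Sum>i\<in>{1..n} - (I \<union> J). (t i)\<^sup>2) + (\<Sum>i\<in>I - J. (t i)\<^sup>2)"
    unfolding sq_bias_def using split[of I J] split[of J I] by auto
  have "(\<Sum>i\<in>{1..n} - J. (t i + z i)\<^sup>2 / 2) - (\<Sum>i\<in>{1..n} - I. (t i + z i)\<^sup>2 / 2)
      \<le> 5 / 4 * sq_bias n t J - sq_bias n t I / 4 + (\<Sum>i\<in>I \<union> J. (z i)\<^sup>2)"
    using eqn up lo noise bias z_nonneg[of "J - I"] t_nonneg[of "{1..n} - (I \<union> J)"] t_nonneg[of "I - J"]
    by argo
  moreover have "score \<kappa> n \<sigma> x I - score \<kappa> n \<sigma> x J =
      (\<kappa> + 1 / 2) * (sparsity_cost n J - sparsity_cost n I) +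
      ((\<Sum>i\<in>{1..n} - J. (t i + z i)\<^sup>2 / 2) - (\<Sum>i\<in>{1..n} - I. (t i + z i)\<^sup>2 / 2))"
    unfolding score_def norm by (simp add: algebra_simps)
  ultimately show ?thesis by simp
qed

text \<open>The negative bias term of \<open>score_diff_le\<close>, multiplied by the power
  \<open>h\<close>, absorbs \<open>a * sq_bias n t I\<close>, and the noise exponents
  \<open>h\<close> and \<open>2 * a\<close> add up to \<open>\<beta>\<close>. The coefficient
  \<open>3 + B\<close> is a budget: one unit is left for a factor
  \<open>exp (sparsity_cost n I)\<close>, \<open>B\<close> units for the moment condition and two
  for summing over \<open>I\<close>.\<close>

lemma eb_weight_exp_le:
  assumes \<sigma>: "\<sigma> > 0" and sel: "max_selector \<kappa> n \<sigma> Ihat" and x: "x \<in> space (Rn n)"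
    and I: "I \<subseteq> {1..n}" and J: "J \<subseteq> {1..n}"
    and \<beta>: "0 < \<beta>" "\<beta> \<le> 1" and \<kappa>: "\<kappa> > 1"
    and g: "g = \<beta> * (\<kappa> + 1 / 4)" "3 + B \<le> g"
    and a: "a = \<beta> / (8 * (\<kappa> + 1 / 2))"
    and z: "\<And>i. i \<in> {1..n} \<Longrightarrow> x i = \<sigma> * (t i + z i)"
  shows "eb_weight kind \<kappa> n \<sigma> Ihat x I * exp (a * sq_bias n t I + 2 * a * (\<Sum>i\<in>I. (z i)\<^sup>2)) \<le>
    exp (- (3 + B) * sparsity_cost n I + (g + 2) * (sparsity_cost n J + sq_bias n t J)
      + \<beta> * (\<Sum>i\<in>I \<union> J. (z i)\<^sup>2))"
proof -
  \<comment> \<open>\<open>2 a\<close> of the available exponent \<open>\<beta>\<close> is kept for the factor \<open>exp (2 a \<Sum>\<^sub>i z\<^sub>i\<^sup>2)\<close>;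
    \<open>a\<close> is such that \<open>h (\<kappa> + 1/2) = g\<close>.\<close>
  define h where "h = \<beta> - 2 * a"
  have [simp]: "finite I" "finite J" using I J finite_subset by blast+
  have a_pos: "a > 0" using \<beta> \<kappa> by (simp add: a)
  \<comment> \<open>\<open>\<kappa> > 1\<close> makes the denominator
    \<open>8 * (\<kappa> + 1/2)\<close> exceed 12.\<close>
  have a12: "12 * a \<le> \<beta>"
  proof -
    have "12 * a = \<beta> * (12 / (8 * (\<kappa> + 1 / 2)))" using a by simp
    also have "\<dots> \<le> \<beta> * 1"
      using \<beta> \<kappa> by (intro mult_left_mono) (auto simp: field_simps)
    finally show ?thesis by simp
  qed
  have h: "0 \<le> h" "h \<le> 1" "4 * a \<le> h" using a12 a_pos \<beta> by (auto simp: h_def)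
  have a\<kappa>: "8 * (a * (\<kappa> + 1 / 2)) = \<beta>" using \<kappa> by (simp add: a field_simps)
  have hg: "h * (\<kappa> + 1 / 2) = g"
    using a\<kappa> unfolding h_def g by (simp add: algebra_simps)
  have ex: "h * (score \<kappa> n \<sigma> x I - score \<kappa> n \<sigma> x J) \<le>
     h * ((\<kappa> + 1 / 2) * (sparsity_cost n J - sparsity_cost n I)
     + 5 / 4 * sq_bias n t J - sq_bias n t I / 4 + (\<Sum>i\<in>I \<union> J. (z i)\<^sup>2))"
    using score_diff_le[OF \<sigma> I J z] h by (intro mult_left_mono) auto
  also have "\<dots> = g * (sparsity_cost n J - sparsity_cost n I)
     + h * 5 / 4 * sq_bias n t J - h / 4 * sq_bias n t I + h * (\<Sum>i\<in>I \<union> J. (z i)\<^sup>2)"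
    unfolding hg[symmetric] by (simp add: algebra_simps)
  finally have ex': "h * (score \<kappa> n \<sigma> x I - score \<kappa> n \<sigma> x J) \<le> \<dots>" .
  have "(\<Sum>i\<in>I. (z i)\<^sup>2) \<le> (\<Sum>i\<in>I \<union> J. (z i)\<^sup>2)" by (rule sum_mono2) auto
  then have 1: "2 * a * (\<Sum>i\<in>I. (z i)\<^sup>2) \<le> 2 * a * (\<Sum>i\<in>I \<union> J. (z i)\<^sup>2)"
    using a_pos by (intro mult_left_mono) auto
  have 2: "a * sq_bias n t I \<le> h / 4 * sq_bias n t I"
    using h sq_bias_nonneg[of n t I] by (intro mult_right_mono) auto
  \<comment> \<open>Here \<open>h \<le> 1\<close> gives \<open>5/4 * h \<le> 2\<close>, and
    \<open>g = h * (\<kappa> + 1/2)\<close> is nonnegative.\<close>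
  have 3: "h * 5 / 4 * sq_bias n t J \<le> (g + 2) * sq_bias n t J"
  proof (rule mult_right_mono[OF _ sq_bias_nonneg])
    have "0 \<le> h * (\<kappa> + 1 / 2)" using h \<kappa> by simp
    then show "h * 5 / 4 \<le> g + 2" using h hg by linarith
  qed
  have 4: "g * sparsity_cost n J \<le> (g + 2) * sparsity_cost n J"
    using sparsity_cost_nonneg[OF J] by (intro mult_right_mono) auto
  have 5: "(3 + B) * sparsity_cost n I \<le> g * sparsity_cost n I"
    using sparsity_cost_nonneg[OF I] g by (intro mult_right_mono) auto
  have 6: "h * (\<Sum>i\<in>I \<union> J. (z i)\<^sup>2) + 2 * a * (\<Sum>i\<in>I \<union> J. (z i)\<^sup>2) = \<beta> * (\<Sum>i\<in>I \<union> J. (z i)\<^sup>2)"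
    by (simp add: h_def algebra_simps)
  have "eb_weight kind \<kappa> n \<sigma> Ihat x I * exp (a * sq_bias n t I + 2 * a * (\<Sum>i\<in>I. (z i)\<^sup>2))
     \<le> exp (h * (score \<kappa> n \<sigma> x I - score \<kappa> n \<sigma> x J)) *
       exp (a * sq_bias n t I + 2 * a * (\<Sum>i\<in>I. (z i)\<^sup>2))"
    using eb_weight_le[OF \<sigma> sel x I J h(1,2)] by (intro mult_right_mono) auto
  also have "\<dots> \<le> exp (- (3 + B) * sparsity_cost n I + (g + 2) * (sparsity_cost n J + sq_bias n t J)
      + \<beta> * (\<Sum>i\<in>I \<union> J. (z i)\<^sup>2))"
    unfolding mult_exp_exp exp_le_cancel_iff
    using ex' 1 2 3 4 5 6 by (simp add: algebra_simps)
  finally show ?thesis .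
qed

section \<open>Expectations under the exponential moment condition\<close>

text \<open>
  Dominates \<open>\<Sum>\<^sub>I W\<^sub>I exp (y\<^sub>I)\<close> for the posterior weights \<open>W\<^sub>I\<close> and all exponents \<open>y\<^sub>I\<close> arising in the
  Markov inequalities; it is manifestly measurable, so no measurability of the weights is needed.
\<close>

definition envelope ::
    "real \<Rightarrow> real \<Rightarrow> real \<Rightarrow> nat \<Rightarrow> (nat \<Rightarrow> real) \<Rightarrow> nat set \<Rightarrow> (nat \<Rightarrow> real) \<Rightarrow> real" where
  "envelope \<beta> B g n t J z = (\<Sum>I\<in>Pow {1..n}.
     exp (- (2 + B) * sparsity_cost n I + (g + 2) * (sparsity_cost n J + sq_bias n t J)
       + \<beta> * (\<Sum>i\<in>I \<union> J. (z i)\<^sup>2)))"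

text \<open>The moment condition is applied to each \<open>I \<union> J\<close> separately. Its
  price \<open>B * card (I \<union> J)\<close> is at most \<open>B\<close> times the sum of both
  sparsity costs: the share of \<open>I\<close> lowers the coefficient \<open>2 + B\<close> to 2,
  which \<open>sum_exp_sparsity_cost\<close> sums, and the share of \<open>J\<close> raises
  \<open>g + 2\<close> to \<open>g + 2 + B\<close>.\<close>

lemma obs_law_nn_integral_le:
  assumes Q: "sets Q = sets (Rn n)" and mom: "exch_exp_moment \<beta> B n Q"
    and \<sigma>: "\<sigma> > 0" and B: "B \<ge> 0" and J: "J \<subseteq> {1..n}"
    and f: "\<And>x. x \<in> space (Rn n) \<Longrightarrow>
      f x \<le> ennreal (exp (- u) * envelope \<beta> B g n t J (\<lambda>i. (x i - \<theta> i) / \<sigma>))"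
  shows "(\<integral>\<^sup>+x. f x \<partial>obs_law n \<sigma> Q \<theta>)
    \<le> ennreal (2 * exp ((g + 2 + B) * (sparsity_cost n J + sq_bias n t J) - u))"
proof -
  define T where "T = (\<lambda>\<xi>. \<lambda>i\<in>{1..n}. \<theta> i + \<sigma> * \<xi> i)"
  define c where "c I = - (2 + B) * sparsity_cost n I + (g + 2) * (sparsity_cost n J + sq_bias n t J)" for I
  note Q[measurable_cong]
  have coord[measurable]: "(\<lambda>\<xi>. \<xi> i) \<in> borel_measurable Q" if "i \<in> {1..n}" for i
    using that unfolding measurable_cong_sets[OF Q refl] Rn_def by measurable
  have T: "T \<in> Q \<rightarrow>\<^sub>M Rn n"
    unfolding T_def Rn_def by measurable
  have coord'[measurable]: "(\<lambda>x. x i) \<in> borel_measurable (Rn n)" if "i \<in> {1..n}" for i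
    using that unfolding Rn_def by measurable
  have sub: "I \<union> J \<subseteq> {1..n}" if "I \<in> Pow {1..n}" for I using that J by auto
  have env_meas: "(\<lambda>x. envelope \<beta> B g n t J (\<lambda>i. (x i - \<theta> i) / \<sigma>)) \<in> borel_measurable (Rn n)"
    unfolding envelope_def
    by (auto intro!: borel_measurable_sum measurable_compose[OF _ borel_measurable_exp]
        borel_measurable_add borel_measurable_times borel_measurable_power
        borel_measurable_divide borel_measurable_diff coord' dest: subsetD[OF sub] subsetD[OF J] simp del: One_nat_def)
  have "(\<integral>\<^sup>+x. f x \<partial>obs_law n \<sigma> Q \<theta>)
      \<le> (\<integral>\<^sup>+x. ennreal (exp (- u) * envelope \<beta> B g n t J (\<lambda>i. (x i - \<theta> i) / \<sigma>)) \<partial>obs_law n \<sigma> Q \<theta>)"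
    by (rule nn_integral_mono) (use f in \<open>auto simp: obs_law_def\<close>)
  also have "\<dots> = (\<integral>\<^sup>+\<xi>. ennreal (exp (- u) * envelope \<beta> B g n t J (\<lambda>i. (T \<xi> i - \<theta> i) / \<sigma>)) \<partial>Q)"
    unfolding obs_law_def T_def[symmetric] using T env_meas by (subst nn_integral_distr) auto
  also have "\<dots> = (\<integral>\<^sup>+\<xi>. (\<Sum>I\<in>Pow {1..n}. ennreal (exp (c I - u)) *
      ennreal (exp (\<beta> * (\<Sum>i\<in>I \<union> J. (\<xi> i)\<^sup>2)))) \<partial>Q)"
  proof (rule nn_integral_cong)
    fix \<xi>
    have "(\<Sum>i\<in>I \<union> J. ((T \<xi> i - \<theta> i) / \<sigma>)\<^sup>2) = (\<Sum>i\<in>I \<union> J. (\<xi> i)\<^sup>2)" if "I \<in> Pow {1..n}" for I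
      using sub[OF that] \<sigma> by (intro sum.cong) (auto simp: T_def)
    note noise = this
    have "exp (- u) * envelope \<beta> B g n t J (\<lambda>i. (T \<xi> i - \<theta> i) / \<sigma>)
        = (\<Sum>I\<in>Pow {1..n}. exp (c I - u) * exp (\<beta> * (\<Sum>i\<in>I \<union> J. (\<xi> i)\<^sup>2)))"
      unfolding envelope_def sum_distrib_left[of "exp (- u)"] mult_exp_exp c_def
    proof (rule sum.cong[OF refl])
      fix I assume I: "I \<in> Pow {1..n}"
      show "exp (- u + (- (2 + B) * sparsity_cost n I + (g + 2) * (sparsity_cost n J + sq_bias n t J)
            + \<beta> * (\<Sum>i\<in>I \<union> J. ((T \<xi> i - \<theta> i) / \<sigma>)\<^sup>2)))
          = exp (- (2 + B) * sparsity_cost n I + (g + 2) * (sparsity_cost n J + sq_bias n t J) - u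
            + \<beta> * (\<Sum>i\<in>I \<union> J. (\<xi> i)\<^sup>2))"
        unfolding noise[OF I] by simp
    qed
    then show "ennreal (exp (- u) * envelope \<beta> B g n t J (\<lambda>i. (T \<xi> i - \<theta> i) / \<sigma>))
        = (\<Sum>I\<in>Pow {1..n}. ennreal (exp (c I - u)) * ennreal (exp (\<beta> * (\<Sum>i\<in>I \<union> J. (\<xi> i)\<^sup>2))))"
      by (simp flip: ennreal_mult)
  qed
  also have "\<dots> = (\<Sum>I\<in>Pow {1..n}. ennreal (exp (c I - u)) *
      (\<integral>\<^sup>+\<xi>. ennreal (exp (\<beta> * (\<Sum>i\<in>I \<union> J. (\<xi> i)\<^sup>2))) \<partial>Q))"
  proof -
    have "(\<lambda>\<xi>. ennreal (exp (\<beta> * (\<Sum>i\<in>I \<union> J. (\<xi> i)\<^sup>2)))) \<in> borel_measurable Q" if "I \<in> Pow {1..n}" for I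
      using sub[OF that] by (auto intro!: measurable_compose[OF _ measurable_ennreal] measurable_compose[OF _ borel_measurable_exp] borel_measurable_times borel_measurable_sum borel_measurable_power coord)
    then show ?thesis
      by (subst nn_integral_sum) (auto intro!: sum.cong nn_integral_cmult)
  qed
  also have "\<dots> \<le> (\<Sum>I\<in>Pow {1..n}. ennreal (exp (c I - u)) * ennreal (exp (B * real (card (I \<union> J)))))"
    using mom sub unfolding exch_exp_moment_def by (intro sum_mono mult_left_mono) auto
  also have "\<dots> = ennreal (\<Sum>I\<in>Pow {1..n}. exp (c I - u + B * real (card (I \<union> J))))"
    by (subst sum_ennreal[symmetric]) (auto simp: exp_add ennreal_mult)
  also have "\<dots> \<le> ennreal (\<Sum>I\<in>Pow {1..n}.
      exp ((g + 2 + B) * (sparsity_cost n J + sq_bias n t J) - u) * exp (- 2 * sparsity_cost n I))"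
  proof (intro ennreal_leI sum_mono)
    fix I assume I: "I \<in> Pow {1..n}"
    have "real (card (I \<union> J)) \<le> real (card I) + real (card J)"
      using card_Un_le[of I J] by linarith
    also have "\<dots> \<le> sparsity_cost n I + (sparsity_cost n J + sq_bias n t J)"
      using I J card_le_sparsity_cost[of I n] card_le_sparsity_cost[of J n] sq_bias_nonneg[of n t J] by auto
    finally have "B * real (card (I \<union> J)) \<le> B * (sparsity_cost n I + (sparsity_cost n J + sq_bias n t J))"
      using B by (rule mult_left_mono)
    then show "exp (c I - u + B * real (card (I \<union> J))) \<le>
        exp ((g + 2 + B) * (sparsity_cost n J + sq_bias n t J) - u) * exp (- 2 * sparsity_cost n I)"
      unfolding mult_exp_exp exp_le_cancel_iff c_def by (simp add: algebra_simps)
  qed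
  also have "\<dots> \<le> ennreal (2 * exp ((g + 2 + B) * (sparsity_cost n J + sq_bias n t J) - u))"
    using mult_left_mono[OF sum_exp_sparsity_cost[of n],
        of "exp ((g + 2 + B) * (sparsity_cost n J + sq_bias n t J) - u)"]
    by (intro ennreal_leI) (simp add: mult.commute flip: sum_distrib_right)
  finally show ?thesis .
qed

section \<open>Gaussian posteriors\<close>

lemma sq_dist_eq: "sq_dist n x y = (\<Sum>i\<in>{1..n}. (x i - y i)\<^sup>2)"
  by (simp add: sq_dist_def L2_set_def sum_nonneg)

lemma prob_space_normal_law: "0 \<le> v \<Longrightarrow> prob_space (normal_law \<mu> v)"
  by (auto simp: normal_law_def prob_space_return intro: prob_space_normal_density)

lemma sets_normal_law [measurable_cong]: "sets (normal_law \<mu> v) = sets borel"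
  by (simp add: normal_law_def)

text \<open>Multiplying the \<open>N(\<mu>, v)\<close> density by the exponential gives
  \<open>sqrt (w / v)\<close> times the \<open>N(\<mu>, w)\<close> density with
  \<open>1 / w = 1 / v - 2 c\<close>. The condition on \<open>c * v\<close> ensures
  \<open>w \<le> 2 v\<close>, and \<open>sqrt 2 \<le> exp (1/2)\<close>.\<close>

lemma nn_integral_normal_law_exp_sq:
  assumes v: "0 \<le> v" and c: "4 * (c * v) \<le> 1"
  shows "(\<integral>\<^sup>+y. ennreal (exp (c * (y - \<mu>)\<^sup>2)) \<partial>normal_law \<mu> v) \<le> ennreal (exp (1 / 2))"
proof (cases "v = 0")
  case True
  then show ?thesis by (simp add: normal_law_def nn_integral_return)
next
  case False
  with v have v: "v > 0" by simp
  define w where "w = v / (1 - 2 * c * v)"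
  have den: "1 - 2 * c * v \<ge> 1 / 2" using c by simp
  then have w: "w > 0" using v by (simp add: w_def)
  have "1 / w = 1 / v - 2 * c" using v den by (simp add: w_def field_simps)
  then have exps: "- (y - \<mu>)\<^sup>2 / (2 * v) + c * (y - \<mu>)\<^sup>2 = - (y - \<mu>)\<^sup>2 / (2 * w)" for y
  proof -
    have "- (y - \<mu>)\<^sup>2 / (2 * w) = - (y - \<mu>)\<^sup>2 / 2 * (1 / w)" by simp
    also have "\<dots> = - (y - \<mu>)\<^sup>2 / 2 * (1 / v - 2 * c)" using \<open>1 / w = _\<close> by simp
    finally show ?thesis by (simp add: algebra_simps)
  qed
  have "normal_density \<mu> (sqrt v) y * exp (c * (y - \<mu>)\<^sup>2)
      = sqrt (w / v) * normal_density \<mu> (sqrt w) y" for y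
    using v w exps[of y] unfolding normal_density_def
    by (simp add: mult_exp_exp real_sqrt_mult real_sqrt_divide)
  then have "(\<integral>\<^sup>+y. ennreal (exp (c * (y - \<mu>)\<^sup>2)) \<partial>normal_law \<mu> v)
      = (\<integral>\<^sup>+y. ennreal (sqrt (w / v)) * ennreal (normal_density \<mu> (sqrt w) y) \<partial>lborel)"
    using v w by (simp add: normal_law_def nn_integral_density flip: ennreal_mult)
  also have "\<dots> = ennreal (sqrt (w / v)) * (\<integral>\<^sup>+y. ennreal (normal_density \<mu> (sqrt w) y) \<partial>lborel)"
    by (rule nn_integral_cmult) simp
  also have "(\<integral>\<^sup>+y. ennreal (normal_density \<mu> (sqrt w) y) \<partial>lborel) = 1"
    using w by (subst nn_integral_eq_integral) auto
  also have "ennreal (sqrt (w / v)) * 1 \<le> ennreal (exp (1 / 2))"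
  proof -
    have "w / v \<le> 2" using v den by (simp add: w_def field_simps)
    also have "(2::real) \<le> exp 1" using exp_ge_add_one_self[of 1] by simp
    also have "exp 1 = (exp (1 / 2 :: real))\<^sup>2" by (simp flip: exp_double)
    finally have "sqrt (w / v) \<le> exp (1 / 2)" by (intro real_le_lsqrt) (auto intro: real_le_lsqrt)
    then show ?thesis by (simp add: ennreal_leI)
  qed
  finally show ?thesis .
qed

lemma sets_post_given [measurable_cong]: "sets (post_given n \<sigma> x I) = sets (Rn n)"
  unfolding post_given_def Rn_def by (intro sets_PiM_cong sets_normal_law) simp

lemma Kn_nonneg:
  assumes I: "I \<subseteq> {1..n}"
  shows "0 \<le> Kn n I"
proof (cases "I = {}")
  case False
  have "finite I" using I finite_subset by blast
  then have "card I > 0" using False by (simp add: card_gt_0_iff)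
  moreover have "card I \<le> n" using card_mono[OF _ I] by simp
  ultimately have "1 * real (card I) \<le> exp 1 * real n"
    by (intro mult_mono) auto
  then show ?thesis
    using \<open>card I > 0\<close> by (auto simp: Kn_def field_simps)
qed (simp add: Kn_def)

lemma prob_space_post_given:
  assumes "I \<subseteq> {1..n}"
  shows "prob_space (post_given n \<sigma> x I)"
  unfolding post_given_def using Kn_nonneg[OF assms]
  by (intro prob_space_PiM prob_space_normal_law) auto

text \<open>\<open>A\<close> need not be measurable, since \<^const>\<open>emeasure\<close> is 0 outside the \<open>\<sigma>\<close>-algebra.\<close>

lemma emeasure_le_nn_integral:
  assumes "\<And>x. x \<in> A \<Longrightarrow> 1 \<le> f x"
  shows "emeasure M A \<le> (\<integral>\<^sup>+x. f x \<partial>M)"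
proof (cases "A \<in> sets M")
  case True
  then have "emeasure M A = (\<integral>\<^sup>+x. indicator A x \<partial>M)" by simp
  also have "\<dots> \<le> (\<integral>\<^sup>+x. f x \<partial>M)"
    using assms by (intro nn_integral_mono) (auto simp: indicator_def)
  finally show ?thesis .
qed (simp add: emeasure_notin_sets)

text \<open>Exponential Markov inequality for a product measure, where the integral factorizes over
  coordinates. Off \<open>I\<close> the factor is a Dirac measure at 0 and contributes to the bias.
  On \<open>I\<close> the error is split at \<open>x i\<close>: its distance to
  \<open>\<theta> i\<close> enters the exponent doubled, and the Gaussian spread costs at most
  \<open>exp (1/2)\<close> per coordinate.\<close>

lemma emeasure_post_given_le:
  assumes \<sigma>: "\<sigma> > 0" and I: "I \<subseteq> {1..n}" and a: "0 \<le> a" "8 * a \<le> 1"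
  shows "emeasure (post_given n \<sigma> x I) {\<eta> \<in> space (Rn n). sq_dist n \<eta> \<theta> \<ge> T} \<le>
    ennreal (exp (- a * T / \<sigma>\<^sup>2) * exp (a * sq_bias n (\<lambda>i. \<theta> i / \<sigma>) I
      + 2 * a * (\<Sum>i\<in>I. ((x i - \<theta> i) / \<sigma>)\<^sup>2) + real (card I) / 2))"
proof -
  define P where "P i = normal_law (x i * indicator I i) (Kn n I * \<sigma>\<^sup>2 * indicator I i / (Kn n I + 1))" for i
  \<comment> \<open>The bound on the log exponential moment contributed by coordinate
    \<open>i\<close>.\<close>
  define b where "b i = (if i \<in> I then 2 * a * ((x i - \<theta> i) / \<sigma>)\<^sup>2 + 1 / 2 else a * (\<theta> i / \<sigma>)\<^sup>2)" for i
  note K = Kn_nonneg[OF I]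
  have "prob_space (P i)" for i
    unfolding P_def using K by (intro prob_space_normal_law) auto
  then interpret P: product_sigma_finite P
    unfolding product_sigma_finite_def using prob_space_imp_sigma_finite by blast
  have sets_P [measurable_cong]: "sets (P i) = sets borel" for i
    by (simp add: P_def sets_normal_law)
  have coord: "(\<integral>\<^sup>+y. ennreal (exp (a * ((y - \<theta> i) / \<sigma>)\<^sup>2)) \<partial>P i) \<le> ennreal (exp (b i))"
    if i: "i \<in> {1..n}" for i
  proof (cases "i \<in> I")
    case False
    then have "P i = return borel 0" by (simp add: P_def normal_law_def)
    then show ?thesis using False by (simp add: nn_integral_return b_def power_divide)
  next
    case True
    define v where "v = Kn n I * \<sigma>\<^sup>2 / (Kn n I + 1)"
    have v: "0 \<le> v" "v \<le> \<sigma>\<^sup>2" using K \<sigma> by (auto simp: v_def field_simps)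
    have P: "P i = normal_law (x i) v" using True by (simp add: P_def v_def)
    have *: "a * ((y - \<theta> i) / \<sigma>)\<^sup>2 \<le> 2 * a * ((x i - \<theta> i) / \<sigma>)\<^sup>2 + 2 * a / \<sigma>\<^sup>2 * (y - x i)\<^sup>2" for y
    proof -
      have "(y - \<theta> i)\<^sup>2 \<le> 2 * (x i - \<theta> i)\<^sup>2 + 2 * (y - x i)\<^sup>2"
        using zero_le_power2[of "(y - x i) - (x i - \<theta> i)"] by (simp add: power2_eq_square algebra_simps)
      then have "a / \<sigma>\<^sup>2 * (y - \<theta> i)\<^sup>2 \<le> a / \<sigma>\<^sup>2 * (2 * (x i - \<theta> i)\<^sup>2 + 2 * (y - x i)\<^sup>2)"
        using a by (intro mult_left_mono) auto
      then show ?thesis by (simp add: power_divide algebra_simps)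
    qed
    have "(\<integral>\<^sup>+y. ennreal (exp (a * ((y - \<theta> i) / \<sigma>)\<^sup>2)) \<partial>P i)
       \<le> (\<integral>\<^sup>+y. ennreal (exp (2 * a * ((x i - \<theta> i) / \<sigma>)\<^sup>2)) *
             ennreal (exp (2 * a / \<sigma>\<^sup>2 * (y - x i)\<^sup>2)) \<partial>P i)"
      using * by (intro nn_integral_mono) (simp add: mult_exp_exp flip: ennreal_mult)
    also have "\<dots> = ennreal (exp (2 * a * ((x i - \<theta> i) / \<sigma>)\<^sup>2)) *
             (\<integral>\<^sup>+y. ennreal (exp (2 * a / \<sigma>\<^sup>2 * (y - x i)\<^sup>2)) \<partial>P i)"
      by (rule nn_integral_cmult) measurable
    also have "\<dots> \<le> ennreal (exp (2 * a * ((x i - \<theta> i) / \<sigma>)\<^sup>2)) * ennreal (exp (1 / 2))"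
    proof (intro mult_left_mono)
      \<comment> \<open>The posterior variance is at most \<open>\<sigma>^2\<close>, so
        \<open>8 * a \<le> 1\<close> is what the Gaussian moment bound asks for.\<close>
      have "4 * (2 * a / \<sigma>\<^sup>2 * v) = 8 * a * (v / \<sigma>\<^sup>2)" by simp
      also have "\<dots> \<le> 1 * 1" using a v \<sigma> by (intro mult_mono) auto
      finally show "(\<integral>\<^sup>+y. ennreal (exp (2 * a / \<sigma>\<^sup>2 * (y - x i)\<^sup>2)) \<partial>P i) \<le> ennreal (exp (1 / 2))"
        unfolding P by (intro nn_integral_normal_law_exp_sq v) simp
    qed simp
    also have "\<dots> = ennreal (exp (b i))"
      using True by (simp add: b_def exp_add flip: ennreal_mult)
    finally show ?thesis .
  qed
  have post: "post_given n \<sigma> x I = Pi\<^sub>M {1..n} P"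
    unfolding post_given_def P_def ..
  have "emeasure (post_given n \<sigma> x I) {\<eta> \<in> space (Rn n). sq_dist n \<eta> \<theta> \<ge> T} \<le>
    (\<integral>\<^sup>+\<eta>. ennreal (exp (- a * T / \<sigma>\<^sup>2)) * (\<Prod>i\<in>{1..n}. ennreal (exp (a * ((\<eta> i - \<theta> i) / \<sigma>)\<^sup>2)))
        \<partial>post_given n \<sigma> x I)"
  proof (rule emeasure_le_nn_integral)
    fix \<eta> assume "\<eta> \<in> {\<eta> \<in> space (Rn n). sq_dist n \<eta> \<theta> \<ge> T}"
    then have "a / \<sigma>\<^sup>2 * T \<le> a / \<sigma>\<^sup>2 * sq_dist n \<eta> \<theta>"
      using a by (intro mult_left_mono) auto
    also have "\<dots> = (\<Sum>i\<in>{1..n}. a * ((\<eta> i - \<theta> i) / \<sigma>)\<^sup>2)"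
      by (simp add: sq_dist_eq power_divide sum_distrib_left)
    finally have "0 \<le> - a * T / \<sigma>\<^sup>2 + (\<Sum>i\<in>{1..n}. a * ((\<eta> i - \<theta> i) / \<sigma>)\<^sup>2)" by simp
    then have "1 \<le> exp (- a * T / \<sigma>\<^sup>2) * (\<Prod>i\<in>{1..n}. exp (a * ((\<eta> i - \<theta> i) / \<sigma>)\<^sup>2))"
      by (simp add: mult_exp_exp flip: exp_sum)
    then show "1 \<le> ennreal (exp (- a * T / \<sigma>\<^sup>2)) * (\<Prod>i\<in>{1..n}. ennreal (exp (a * ((\<eta> i - \<theta> i) / \<sigma>)\<^sup>2)))"
      by (simp add: prod_ennreal flip: ennreal_mult' ennreal_1)
  qed
  also have "\<dots> = ennreal (exp (- a * T / \<sigma>\<^sup>2)) *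
     (\<integral>\<^sup>+\<eta>. (\<Prod>i\<in>{1..n}. ennreal (exp (a * ((\<eta> i - \<theta> i) / \<sigma>)\<^sup>2))) \<partial>Pi\<^sub>M {1..n} P)"
    unfolding post by (rule nn_integral_cmult) measurable
  also have "(\<integral>\<^sup>+\<eta>. (\<Prod>i\<in>{1..n}. ennreal (exp (a * ((\<eta> i - \<theta> i) / \<sigma>)\<^sup>2))) \<partial>Pi\<^sub>M {1..n} P)
      = (\<Prod>i\<in>{1..n}. \<integral>\<^sup>+y. ennreal (exp (a * ((y - \<theta> i) / \<sigma>)\<^sup>2)) \<partial>P i)"
    by (rule P.product_nn_integral_prod) auto
  also have "ennreal (exp (- a * T / \<sigma>\<^sup>2)) * \<dots>
     \<le> ennreal (exp (- a * T / \<sigma>\<^sup>2)) * (\<Prod>i\<in>{1..n}. ennreal (exp (b i)))"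
    by (intro mult_left_mono prod_mono_ennreal coord) auto
  also have "\<dots> = ennreal (exp (- a * T / \<sigma>\<^sup>2) * exp (\<Sum>i\<in>{1..n}. b i))"
    by (simp add: exp_sum prod_ennreal prod_nonneg ennreal_mult)
  also have "(\<Sum>i\<in>{1..n}. b i) = a * sq_bias n (\<lambda>i. \<theta> i / \<sigma>) I
      + 2 * a * (\<Sum>i\<in>I. ((x i - \<theta> i) / \<sigma>)\<^sup>2) + real (card I) / 2"
    unfolding b_def using I
    by (subst sum.If_cases)
      (auto simp: Int_absorb1 Diff_eq sq_bias_def sum.distrib sum_distrib_left)
  finally show ?thesis .
qed

lemma emeasure_eb_posterior:
  assumes \<sigma>: "\<sigma> > 0" and sel: "max_selector \<kappa> n \<sigma> Ihat" and x: "x \<in> space (Rn n)"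
    and A: "A \<in> sets (Rn n)"
  shows "emeasure (eb_posterior kind \<kappa> n \<sigma> Ihat x) A =
    (\<Sum>I\<in>Pow {1..n}. ennreal (eb_weight kind \<kappa> n \<sigma> Ihat x I) * emeasure (post_given n \<sigma> x I) A)"
proof (cases kind)
  case Averaging
  \<comment> \<open>The index space is discrete, so any family of probability measures on it is a
    kernel.\<close>
  have "post_given n \<sigma> x \<in> point_measure (Pow {1..n}) (\<lambda>I. ennreal (post_set \<kappa> n \<sigma> x I))
      \<rightarrow>\<^sub>M subprob_algebra (Rn n)"
    by (auto simp: space_subprob_algebra sets_post_given prob_space_post_given
        intro: prob_space_imp_subprob_space)
  from emeasure_bind[OF _ this A] show ?thesis
    using Averaging
    by (auto simp: post_mix_def space_point_measure nn_integral_point_measure_finite eb_weight_def)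
next
  case Selection
  have "(\<Sum>I\<in>Pow {1..n}. ennreal (of_bool (Ihat x = I)) * emeasure (post_given n \<sigma> x I) A)
     = (\<Sum>I\<in>{Ihat x}. emeasure (post_given n \<sigma> x I) A)"
    using max_selectorD(1)[OF sel x] by (intro sum.mono_neutral_cong_right) auto
  then show ?thesis using Selection by (simp add: eb_weight_def)
qed

section \<open>Concentration relative to a reference set\<close>

lemma proj_sq_dist:
  assumes \<sigma>: "\<sigma> > 0" and I: "I \<subseteq> {1..n}"
  shows "sq_dist n (proj n x I) \<theta> =
    \<sigma>\<^sup>2 * (sq_bias n (\<lambda>i. \<theta> i / \<sigma>) I + (\<Sum>i\<in>I. ((x i - \<theta> i) / \<sigma>)\<^sup>2))"
proof -
  have "sq_dist n (proj n x I) \<theta> = (\<Sum>i\<in>{1..n}. if i \<in> I then (x i - \<theta> i)\<^sup>2 else (\<theta> i)\<^sup>2)"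
    unfolding sq_dist_eq by (intro sum.cong refl) (auto simp: proj_def)
  also have "\<dots> = (\<Sum>i\<in>I. (x i - \<theta> i)\<^sup>2) + (\<Sum>i\<in>{1..n} - I. (\<theta> i)\<^sup>2)"
    using I by (subst sum.If_cases) (auto simp: Int_absorb1 Diff_eq)
  finally show ?thesis
    using \<sigma> by (simp add: sq_bias_def power_divide distrib_left flip: sum_divide_distrib)
qed

lemma eb_estimator_eq:
  assumes sel: "max_selector \<kappa> n \<sigma> Ihat" and x: "x \<in> space (Rn n)" and i: "i \<in> {1..n}"
  shows "eb_estimator kind \<kappa> n \<sigma> Ihat x i =
    (\<Sum>I\<in>Pow {1..n}. eb_weight kind \<kappa> n \<sigma> Ihat x I * proj n x I i)"
proof (cases kind)
  case Averaging
  then show ?thesis using i by (simp add: mean_mix_def eb_weight_def mult.commute)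
next
  case Selection
  have "(\<Sum>I\<in>Pow {1..n}. of_bool (Ihat x = I) * proj n x I i) = (\<Sum>I\<in>{Ihat x}. proj n x I i)"
    using max_selectorD(1)[OF sel x] by (intro sum.mono_neutral_cong_right) auto
  then show ?thesis using Selection by (simp add: eb_weight_def)
qed

text \<open>Jensen's inequality for the square in each coordinate: either estimator is the weighted
  mean of the projections, with weights summing to 1.\<close>

lemma sq_dist_eb_estimator_le:
  assumes \<sigma>: "\<sigma> > 0" and sel: "max_selector \<kappa> n \<sigma> Ihat" and x: "x \<in> space (Rn n)"
  shows "sq_dist n (eb_estimator kind \<kappa> n \<sigma> Ihat x) \<theta> \<le>
    (\<Sum>I\<in>Pow {1..n}. eb_weight kind \<kappa> n \<sigma> Ihat x I * sq_dist n (proj n x I) \<theta>)"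
proof -
  define w where "w = eb_weight kind \<kappa> n \<sigma> Ihat x"
  have w: "(\<Sum>I\<in>Pow {1..n}. w I) = 1" "\<And>I. I \<in> Pow {1..n} \<Longrightarrow> 0 \<le> w I"
    using sum_eb_weight[OF \<sigma> sel x] eb_weight_nonneg[OF _ \<sigma>] by (auto simp: w_def)
  have "(eb_estimator kind \<kappa> n \<sigma> Ihat x i - \<theta> i)\<^sup>2
      \<le> (\<Sum>I\<in>Pow {1..n}. w I * (proj n x I i - \<theta> i)\<^sup>2)" if i: "i \<in> {1..n}" for i
  proof -
    have "eb_estimator kind \<kappa> n \<sigma> Ihat x i - \<theta> i = (\<Sum>I\<in>Pow {1..n}. w I * (proj n x I i - \<theta> i))"
      using eb_estimator_eq[OF sel x i] w(1)
      by (simp add: w_def right_diff_distrib sum_subtractf flip: sum_distrib_right)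
    then show ?thesis
      using convex_on_sum[OF _ _ convex_power2 w, of "\<lambda>I. proj n x I i - \<theta> i"] by auto
  qed
  then have "sq_dist n (eb_estimator kind \<kappa> n \<sigma> Ihat x) \<theta>
      \<le> (\<Sum>i\<in>{1..n}. \<Sum>I\<in>Pow {1..n}. w I * (proj n x I i - \<theta> i)\<^sup>2)"
    unfolding sq_dist_eq by (rule sum_mono)
  also have "\<dots> = (\<Sum>I\<in>Pow {1..n}. w I * sq_dist n (proj n x I) \<theta>)"
    unfolding sq_dist_eq sum_distrib_left by (rule sum.swap)
  finally show ?thesis by (simp add: w_def)
qed

text \<open>The hypothesis on \<open>y\<close> is the common bound of the exponents in the three
  claims. Its term \<open>sparsity_cost n I\<close> uses one unit of the budget
  \<open>3 + B\<close>, leaving the \<open>2 + B\<close> of the envelope.\<close>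

lemma eb_weight_sum_le_envelope:
  assumes \<sigma>: "\<sigma> > 0" and sel: "max_selector \<kappa> n \<sigma> Ihat" and x: "x \<in> space (Rn n)"
    and J: "J \<subseteq> {1..n}"
    and \<beta>: "0 < \<beta>" "\<beta> \<le> 1" and \<kappa>: "\<kappa> > 1"
    and g: "g = \<beta> * (\<kappa> + 1 / 4)" "3 + B \<le> g"
    and a: "a = \<beta> / (8 * (\<kappa> + 1 / 2))"
    and y: "\<And>I. I \<subseteq> {1..n} \<Longrightarrow> y I \<le> a * sq_bias n (\<lambda>i. \<theta> i / \<sigma>) I
      + 2 * a * (\<Sum>i\<in>I. ((x i - \<theta> i) / \<sigma>)\<^sup>2) + sparsity_cost n I"
  shows "(\<Sum>I\<in>Pow {1..n}. eb_weight kind \<kappa> n \<sigma> Ihat x I * exp (y I)) \<le>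
    envelope \<beta> B g n (\<lambda>i. \<theta> i / \<sigma>) J (\<lambda>i. (x i - \<theta> i) / \<sigma>)"
  unfolding envelope_def
proof (rule sum_mono)
  fix I assume "I \<in> Pow {1..n}"
  then have I: "I \<subseteq> {1..n}" by simp
  let ?t = "\<lambda>i. \<theta> i / \<sigma>" and ?z = "\<lambda>i. (x i - \<theta> i) / \<sigma>" and ?w = "eb_weight kind \<kappa> n \<sigma> Ihat x I"
  \<comment> \<open>Signal plus noise in units of \<open>\<sigma>\<close>; the noise is defined as
    the residual, so this holds for every \<open>x\<close>.\<close>
  have xz: "x i = \<sigma> * (?t i + ?z i)" for i using \<sigma> by (simp add: field_simps)
  have "?w * exp (y I) \<le> ?w * exp (a * sq_bias n ?t I + 2 * a * (\<Sum>i\<in>I. (?z i)\<^sup>2) + sparsity_cost n I)"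
    using y[OF I] eb_weight_nonneg[OF I \<sigma>] by (intro mult_left_mono) auto
  also have "\<dots> = ?w * exp (a * sq_bias n ?t I + 2 * a * (\<Sum>i\<in>I. (?z i)\<^sup>2)) * exp (sparsity_cost n I)"
    by (simp add: exp_add)
  also have "\<dots> \<le> exp (- (3 + B) * sparsity_cost n I + (g + 2) * (sparsity_cost n J + sq_bias n ?t J)
      + \<beta> * (\<Sum>i\<in>I \<union> J. (?z i)\<^sup>2)) * exp (sparsity_cost n I)"
    by (intro mult_right_mono eb_weight_exp_le[OF \<sigma> sel x I J \<beta> \<kappa> g a xz]) auto
  also have "\<dots> = exp (- (2 + B) * sparsity_cost n I + (g + 2) * (sparsity_cost n J + sq_bias n ?t J)
      + \<beta> * (\<Sum>i\<in>I \<union> J. (?z i)\<^sup>2))"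
    unfolding mult_exp_exp by (rule arg_cong[where f = exp]) (simp add: algebra_simps)
  finally show "?w * exp (y I) \<le> \<dots>" .
qed

text \<open>Each claim is a Markov inequality whose exponential is dominated by the envelope. The
  posterior and estimator claims use the rate \<open>a\<close> in the squared error, the radius
  claim the rate 1 in the sparsity cost.\<close>

lemma eb_bounds:
  assumes \<sigma>: "\<sigma> > 0" and sel: "max_selector \<kappa> n \<sigma> Ihat"
    and Q: "sets Q = sets (Rn n)" and mom: "exch_exp_moment \<beta> B n Q"
    and J: "J \<subseteq> {1..n}"
    and \<beta>: "0 < \<beta>" "\<beta> \<le> 1" and \<kappa>: "\<kappa> > 1" and B: "B > 0"
    and g: "g = \<beta> * (\<kappa> + 1 / 4)" "3 + B \<le> g"
    and a: "a = \<beta> / (8 * (\<kappa> + 1 / 2))"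
    and R: "sparsity_cost n J + sq_bias n (\<lambda>i. \<theta> i / \<sigma>) J \<le> R"
  shows eb_posterior_bound:
    "(\<integral>\<^sup>+x. emeasure (eb_posterior kind \<kappa> n \<sigma> Ihat x) {\<eta> \<in> space (Rn n). sq_dist n \<eta> \<theta> \<ge> T}
        \<partial>obs_law n \<sigma> Q \<theta>) \<le> ennreal (2 * exp ((g + 2 + B) * R - a * T / \<sigma>\<^sup>2))" (is ?post)
    and eb_estimator_bound:
    "emeasure (obs_law n \<sigma> Q \<theta>)
        {x \<in> space (Rn n). sq_dist n (eb_estimator kind \<kappa> n \<sigma> Ihat x) \<theta> \<ge> T}
      \<le> ennreal (2 * exp ((g + 2 + B) * R - a * T / \<sigma>\<^sup>2))" (is ?est)
    and eb_radius_bound: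
    "emeasure (obs_law n \<sigma> Q \<theta>) {x \<in> space (Rn n). eb_radius_sq n \<sigma> (Ihat x) \<ge> T}
      \<le> ennreal (2 * exp ((g + 2 + B) * R - (T / \<sigma>\<^sup>2 - 1)))" (is ?rad)
proof -
  let ?t = "\<lambda>i. \<theta> i / \<sigma>"
  let ?z = "\<lambda>x i. (x i - \<theta> i) / \<sigma>"
  let ?w = "\<lambda>k. eb_weight k \<kappa> n \<sigma> Ihat"
  let ?env = "\<lambda>x. envelope \<beta> B g n ?t J (?z x)"
  note envelope = eb_weight_sum_le_envelope[OF \<sigma> sel _ J \<beta> \<kappa> g a]
  have w_nonneg: "0 \<le> ?w k x I" if "I \<subseteq> {1..n}" for k x I
    using eb_weight_nonneg[OF that \<sigma>] .
  have a_pos: "0 < a" using \<beta> \<kappa> by (simp add: a)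
  have a8: "8 * a \<le> 1"
  proof -
    have "8 * a = \<beta> / (\<kappa> + 1 / 2)" using \<kappa> by (simp add: a field_simps)
    then show ?thesis using \<beta> \<kappa> by simp
  qed
  have zsum: "0 \<le> (\<Sum>i\<in>I. (?z x i)\<^sup>2)" for I x by (rule sum_nonneg) simp
  have upper: "(\<integral>\<^sup>+x. f x \<partial>obs_law n \<sigma> Q \<theta>) \<le> ennreal (2 * exp ((g + 2 + B) * R - u))"
    if "\<And>x. x \<in> space (Rn n) \<Longrightarrow> f x \<le> ennreal (exp (- u) * ?env x)" for f u
  proof -
    have "(g + 2 + B) * (sparsity_cost n J + sq_bias n ?t J) \<le> (g + 2 + B) * R"
      using R g B by (intro mult_left_mono) auto
    then have "ennreal (2 * exp ((g + 2 + B) * (sparsity_cost n J + sq_bias n ?t J) - u))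
        \<le> ennreal (2 * exp ((g + 2 + B) * R - u))"
      by (intro ennreal_leI) simp
    with obs_law_nn_integral_le[OF Q mom \<sigma> less_imp_le[OF B] J that] show ?thesis
      by (rule order.trans)
  qed
  \<comment> \<open>Markov's inequality for an event on which the scaled envelope is at least
    1.\<close>
  have upper': "emeasure (obs_law n \<sigma> Q \<theta>) {x \<in> space (Rn n). P x} \<le> ennreal (2 * exp ((g + 2 + B) * R - u))"
    if "\<And>x. x \<in> space (Rn n) \<Longrightarrow> P x \<Longrightarrow> 1 \<le> exp (- u) * ?env x" for P u
  proof -
    have env: "0 \<le> ?env x" for x unfolding envelope_def by (rule sum_nonneg) simp
    have "emeasure (obs_law n \<sigma> Q \<theta>) {x \<in> space (Rn n). P x}
        \<le> (\<integral>\<^sup>+x. ennreal (exp (- u) * ?env x) \<partial>obs_law n \<sigma> Q \<theta>)"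
    proof (rule emeasure_le_nn_integral)
      fix x assume "x \<in> {x \<in> space (Rn n). P x}"
      then have "1 \<le> exp (- u) * ?env x" using that by simp
      then show "1 \<le> ennreal (exp (- u) * ?env x)" by simp
    qed
    also have "\<dots> \<le> ennreal (2 * exp ((g + 2 + B) * R - u))"
      by (rule upper) simp
    finally show ?thesis .
  qed
  show ?post
  proof (rule upper)
    fix x assume x: "x \<in> space (Rn n)"
    let ?A = "{\<eta> \<in> space (Rn n). sq_dist n \<eta> \<theta> \<ge> T}"
    let ?y = "\<lambda>I. a * sq_bias n ?t I + 2 * a * (\<Sum>i\<in>I. (?z x i)\<^sup>2) + real (card I) / 2"
    have A: "?A \<in> sets (Rn n)"
      unfolding sq_dist_eq Rn_def by measurable
    have "emeasure (eb_posterior kind \<kappa> n \<sigma> Ihat x) ?A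
        = (\<Sum>I\<in>Pow {1..n}. ennreal (?w kind x I) * emeasure (post_given n \<sigma> x I) ?A)"
      by (rule emeasure_eb_posterior[OF \<sigma> sel x A])
    also have "\<dots> \<le> (\<Sum>I\<in>Pow {1..n}. ennreal (?w kind x I) * ennreal (exp (- a * T / \<sigma>\<^sup>2) * exp (?y I)))"
      using a_pos a8 by (intro sum_mono mult_left_mono emeasure_post_given_le[OF \<sigma>]) auto
    also have "\<dots> = ennreal (exp (- (a * T / \<sigma>\<^sup>2)) * (\<Sum>I\<in>Pow {1..n}. ?w kind x I * exp (?y I)))"
    proof -
      have "ennreal (?w kind x I) * ennreal (exp (- a * T / \<sigma>\<^sup>2) * exp (?y I))
          = ennreal (exp (- (a * T / \<sigma>\<^sup>2)) * (?w kind x I * exp (?y I)))" if "I \<in> Pow {1..n}" for I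
        using that w_nonneg[of I] by (simp add: mult_ac flip: ennreal_mult)
      then have "(\<Sum>I\<in>Pow {1..n}. ennreal (?w kind x I) * ennreal (exp (- a * T / \<sigma>\<^sup>2) * exp (?y I)))
          = (\<Sum>I\<in>Pow {1..n}. ennreal (exp (- (a * T / \<sigma>\<^sup>2)) * (?w kind x I * exp (?y I))))"
        by (rule sum.cong[OF refl])
      also have "\<dots> = ennreal (\<Sum>I\<in>Pow {1..n}. exp (- (a * T / \<sigma>\<^sup>2)) * (?w kind x I * exp (?y I)))"
        using w_nonneg by (intro sum_ennreal) auto
      finally show ?thesis
        unfolding sum_distrib_left[of "exp (- (a * T / \<sigma>\<^sup>2))"] .
    qed
    also have "\<dots> \<le> ennreal (exp (- (a * T / \<sigma>\<^sup>2)) * ?env x)"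
    proof (intro ennreal_leI mult_left_mono envelope[OF x])
      fix I :: "nat set" assume I: "I \<subseteq> {1..n}"
      show "?y I \<le> a * sq_bias n ?t I + 2 * a * (\<Sum>i\<in>I. (?z x i)\<^sup>2) + sparsity_cost n I"
        using card_le_sparsity_cost[OF I] by linarith
    qed simp
    finally show "emeasure (eb_posterior kind \<kappa> n \<sigma> Ihat x) ?A \<le> ennreal (exp (- (a * T / \<sigma>\<^sup>2)) * ?env x)" .
  qed
  show ?est
  proof (rule upper')
    fix x assume x: "x \<in> space (Rn n)" and T: "T \<le> sq_dist n (eb_estimator kind \<kappa> n \<sigma> Ihat x) \<theta>"
    let ?d = "\<lambda>I. a * (sq_bias n ?t I + (\<Sum>i\<in>I. (?z x i)\<^sup>2))"
    note T
    also note sq_dist_eb_estimator_le[OF \<sigma> sel x]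
    finally have "a / \<sigma>\<^sup>2 * T \<le> a / \<sigma>\<^sup>2 * (\<Sum>I\<in>Pow {1..n}. ?w kind x I * sq_dist n (proj n x I) \<theta>)"
      using a_pos by (intro mult_left_mono) auto
    also have "\<dots> = (\<Sum>I\<in>Pow {1..n}. ?w kind x I * ?d I)"
      unfolding sum_distrib_left using \<sigma> by (intro sum.cong refl) (simp add: proj_sq_dist)
    finally have "1 \<le> exp (- (a * T / \<sigma>\<^sup>2)) * exp (\<Sum>I\<in>Pow {1..n}. ?w kind x I * ?d I)"
      by (simp add: mult_exp_exp)
    \<comment> \<open>Jensen's inequality again, now for the exponential, brings the error into the
      form that the envelope dominates.\<close>
    also have "exp (\<Sum>I\<in>Pow {1..n}. ?w kind x I * ?d I) \<le> (\<Sum>I\<in>Pow {1..n}. ?w kind x I * exp (?d I))"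
      using convex_on_sum[OF _ _ exp_convex sum_eb_weight[OF \<sigma> sel x, of kind], where y = ?d] w_nonneg by auto
    also have "\<dots> \<le> ?env x"
    proof (rule envelope[OF x])
      fix I :: "nat set" assume I: "I \<subseteq> {1..n}"
      have "0 \<le> a * (\<Sum>i\<in>I. (?z x i)\<^sup>2)" using zsum[of x I] a_pos by simp
      then show "?d I \<le> a * sq_bias n ?t I + 2 * a * (\<Sum>i\<in>I. (?z x i)\<^sup>2) + sparsity_cost n I"
        unfolding distrib_left using sparsity_cost_nonneg[OF I] by linarith
    qed
    finally show "1 \<le> exp (- (a * T / \<sigma>\<^sup>2)) * ?env x" by simp
  qed
  show ?rad
  proof (rule upper')
    fix x assume x: "x \<in> space (Rn n)" and T: "T \<le> eb_radius_sq n \<sigma> (Ihat x)"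
    have "eb_radius_sq n \<sigma> (Ihat x) = \<sigma>\<^sup>2 * (1 + sparsity_cost n (Ihat x))"
      by (simp add: eb_radius_sq_def sparsity_cost_def algebra_simps)
    with T have "T / \<sigma>\<^sup>2 - 1 \<le> sparsity_cost n (Ihat x)"
      using \<sigma> by (simp add: field_simps)
    then have "1 \<le> exp (- (T / \<sigma>\<^sup>2 - 1)) * exp (sparsity_cost n (Ihat x))"
      by (simp add: mult_exp_exp)
    also have "exp (sparsity_cost n (Ihat x)) = (\<Sum>I\<in>{Ihat x}. exp (sparsity_cost n I))" by simp
    \<comment> \<open>The radius depends on the selected set for both procedures, so the weights are
      those of \<open>Selection\<close> whatever \<open>kind\<close> is.\<close>
    also have "\<dots> = (\<Sum>I\<in>Pow {1..n}. ?w Selection x I * exp (sparsity_cost n I))"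
      using max_selectorD(1)[OF sel x]
      by (intro sum.mono_neutral_cong_left) (auto simp: eb_weight_def)
    also have "\<dots> \<le> ?env x"
    proof (rule envelope[OF x])
      fix I :: "nat set" assume I: "I \<subseteq> {1..n}"
      show "sparsity_cost n I \<le> a * sq_bias n ?t I + 2 * a * (\<Sum>i\<in>I. (?z x i)\<^sup>2) + sparsity_cost n I"
        using zsum[of x I] sq_bias_nonneg[of n ?t I] a_pos by simp
    qed
    finally show "1 \<le> exp (- (T / \<sigma>\<^sup>2 - 1)) * ?env x" by simp
  qed
qed

section \<open>Reference sets on weak balls\<close>

text \<open>Integral comparison without integrals: by the mean value theorem each term is at most an
  increment of \<open>- y powr (1 - q) / (q - 1)\<close>, and the increments telescope.\<close>

lemma sum_powr_tail_le:
  fixes q :: real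
  assumes q: "q > 1" and k: "k \<ge> 1" "k \<le> n"
  shows "(\<Sum>i\<in>{k<..n}. real i powr - q) \<le> real k powr (1 - q) / (q - 1)"
proof -
  have "(\<Sum>i\<in>{k<..n}. real i powr - q) \<le> (real k powr (1 - q) - real n powr (1 - q)) / (q - 1)"
    using k(2)
  proof (induction n rule: dec_induct)
    case (step m)
    have m: "m \<ge> 1" using step k by simp
    have "\<exists>y. y > real m \<and> y < real m + 1 \<and>
        (real m + 1) powr (1 - q) - real m powr (1 - q) = (real m + 1 - real m) * ((1 - q) * y powr (- q))"
    proof (rule MVT2)
      fix y assume "real m \<le> y"
      then have "y > 0" using m by simp
      then show "((\<lambda>y. y powr (1 - q)) has_real_derivative (1 - q) * y powr (- q)) (at y)"
        by (auto intro!: derivative_eq_intros)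
    qed simp
    then obtain y where y: "y > real m" "y < real m + 1"
      "real m powr (1 - q) - (real m + 1) powr (1 - q) = (q - 1) * y powr (- q)"
      by (auto simp: algebra_simps)
    have "(real m + 1) powr - q \<le> y powr - q"
      using y(1,2) m q by (intro powr_mono2') auto
    then have "(real m + 1) powr - q \<le> (real m powr (1 - q) - (real m + 1) powr (1 - q)) / (q - 1)"
      unfolding y(3) using q by simp
    moreover have "{k<..Suc m} = insert (Suc m) {k<..m}" using step by auto
    ultimately show ?case
      using step.IH q by (simp add: diff_divide_distrib add.commute)
  qed simp
  also have "\<dots> \<le> real k powr (1 - q) / (q - 1)"
    using q by (intro divide_right_mono) auto
  finally show ?thesis .
qed

lemma ordered_sq_reindex:
  obtains f where "bij_betw f {1..n} {1..n}" "\<And>i. i \<in> {1..n} \<Longrightarrow> ordered_sq n \<theta> i = (\<theta> (f i))\<^sup>2"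
proof -
  define ys where "ys = map (\<lambda>j. (\<theta> j)\<^sup>2) [1..<n + 1]"
  have len: "length ys = n" by (simp add: ys_def)
  have "mset (rev (sort ys)) = mset ys" by simp
  then obtain p where p: "p permutes {..<length ys}" "permute_list p ys = rev (sort ys)"
    by (rule mset_eq_permutation)
  \<comment> \<open>List positions start at 0, ranks and coordinates at 1.\<close>
  define f where "f = Suc \<circ> p \<circ> (\<lambda>i. i - 1)"
  have "bij_betw (\<lambda>i. i - 1) {1..n} {..<n}"
    by (rule bij_betw_byWitness[where f' = Suc]) auto
  moreover have "bij_betw p {..<n} {..<n}"
    using p(1) by (simp add: len permutes_imp_bij)
  moreover have "bij_betw Suc {..<n} {1..n}"
    by (rule bij_betw_byWitness[where f' = "\<lambda>i. i - 1"]) auto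
  ultimately have "bij_betw f {1..n} {1..n}"
    unfolding f_def by (blast intro: bij_betw_trans)
  moreover have "ordered_sq n \<theta> i = (\<theta> (f i))\<^sup>2" if i: "i \<in> {1..n}" for i
  proof -
    have i': "i - 1 < length ys" using i len by auto
    have "ordered_sq n \<theta> i = rev (sort ys) ! (i - 1)"
      by (simp add: ordered_sq_def ys_def)
    also have "\<dots> = ys ! p (i - 1)"
      unfolding p(2)[symmetric] using permute_list_nth[OF p(1) i'] .
    also have "p (i - 1) < n"
      using permutes_in_image[OF p(1), of "i - 1"] i' len by simp
    then have "ys ! p (i - 1) = (\<theta> (f i))\<^sup>2"
      by (simp add: ys_def f_def nth_append del: upt_Suc)
    finally show ?thesis .
  qed
  ultimately show ?thesis by (rule that)
qed

text \<open>\<open>J\<close> consists of the coordinates of the \<open>k\<close> largest squares;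
  the others are bounded rank by rank by the definition of the weak ball. The value
  \<open>k = 0\<close> is allowed and gives the empty set.\<close>

lemma weak_ball_sq_bias_le:
  assumes \<sigma>: "\<sigma> > 0" and \<theta>: "\<theta> \<in> weak_ball s n p" and k: "k \<le> n"
  obtains J where "J \<subseteq> {1..n}" "card J = k"
    "sq_bias n (\<lambda>i. \<theta> i / \<sigma>) J \<le>
      (p / (real n * \<sigma>))\<^sup>2 * real n powr (2 / s) * (\<Sum>i\<in>{k<..n}. real i powr - (2 / s))"
proof -
  obtain f where f: "bij_betw f {1..n} {1..n}"
    and ord: "\<And>i. i \<in> {1..n} \<Longrightarrow> ordered_sq n \<theta> i = (\<theta> (f i))\<^sup>2"
    using ordered_sq_reindex by blast
  have sub: "{1..k} \<subseteq> {1..n}" "{k<..n} \<subseteq> {1..n}" "{1..n} - {1..k} = {k<..n}" using k by auto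
  have inj: "inj_on f {1..n}" and im: "f ` {1..n} = {1..n}" using f by (auto simp: bij_betw_def)
  have diff: "{1..n} - f ` {1..k} = f ` {k<..n}"
    using inj_on_image_set_diff[OF inj, of "{1..n}" "{1..k}"] sub im by auto
  have "sq_bias n (\<lambda>i. \<theta> i / \<sigma>) (f ` {1..k}) = (\<Sum>i\<in>{k<..n}. (\<theta> (f i) / \<sigma>)\<^sup>2)"
    unfolding sq_bias_def diff
    by (subst sum.reindex[OF inj_on_subset[OF inj sub(2)]]) simp
  also have "\<dots> \<le> (\<Sum>i\<in>{k<..n}. (p / (real n * \<sigma>))\<^sup>2 * real n powr (2 / s) * real i powr - (2 / s))"
  proof (rule sum_mono)
    fix i assume "i \<in> {k<..n}"
    then have i: "i \<in> {1..n}" by auto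
    with \<theta> have "(\<theta> (f i))\<^sup>2 \<le> (p / real n)\<^sup>2 * (real n / real i) powr (2 / s)"
      unfolding weak_ball_def ord[OF i, symmetric] by blast
    then have "(\<theta> (f i))\<^sup>2 / \<sigma>\<^sup>2 \<le> (p / real n)\<^sup>2 * (real n / real i) powr (2 / s) / \<sigma>\<^sup>2"
      by (rule divide_right_mono) simp
    then show "(\<theta> (f i) / \<sigma>)\<^sup>2 \<le> (p / (real n * \<sigma>))\<^sup>2 * real n powr (2 / s) * real i powr - (2 / s)"
      by (simp add: power_divide power_mult_distrib powr_divide powr_minus_divide mult_ac)
  qed
  also have "\<dots> = (p / (real n * \<sigma>))\<^sup>2 * real n powr (2 / s) * (\<Sum>i\<in>{k<..n}. real i powr - (2 / s))"
    by (simp add: sum_distrib_left)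
  finally show ?thesis
    using sub(1) im card_image[OF inj_on_subset[OF inj sub(1)]]
    by (intro that[of "f ` {1..k}"]) auto
qed

section \<open>The oracle cost compared with the rate\<close>

text \<open>\<open>1 + s powr - (s/2)\<close> pays for rounding the size of the reference set up to
  an integer, \<open>1 + 3 s / 2\<close> for the logarithm in its sparsity cost, and
  \<open>s / (2 - s)\<close> is the constant of the tail sum with exponent
  \<open>2 / s\<close>.\<close>

definition rate_const :: "real \<Rightarrow> real" where
  "rate_const s = (1 + s powr - (s / 2)) * (1 + 3 * s / 2) + s / (2 - s)"

lemma rate_const_pos: "0 < s \<Longrightarrow> s < 2 \<Longrightarrow> rate_const s > 0"
  unfolding rate_const_def by (intro add_pos_pos mult_pos_pos) (auto simp: add_pos_nonneg)

text \<open>The two regimes are those of the rate. In the sparser one the empty set suffices and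
  only bias remains. In the other, cost and bias are both multiples of \<open>ks * L\<close>, and
  \<open>\<sigma>^2 * (ks * L)\<close> is exactly the rate.\<close>

lemma weak_ball_oracle_le:
  assumes s: "0 < s" "s < 2" and \<sigma>: "\<sigma> > 0" and p: "p > 0"
    and n: "n \<ge> 3" and small: "p \<le> exp (- 1) * (\<sigma> * real n)"
    and \<theta>: "\<theta> \<in> weak_ball s n p"
  obtains J where "J \<subseteq> {1..n}"
    "sparsity_cost n J + sq_bias n (\<lambda>i. \<theta> i / \<sigma>) J \<le> rate_const s * weak_rate_sq s n \<sigma> p / \<sigma>\<^sup>2"
proof -
  define \<eta> where "\<eta> = p / (real n * \<sigma>)"
  define q where "q = 2 / s"
  define N where "N = real n"
  have N: "N \<ge> 3" using n by (simp add: N_def)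
  have q: "q > 1" using s by (simp add: q_def)
  have q1: "1 / (q - 1) = s / (2 - s)" using s by (simp add: q_def field_simps)
  have \<eta>: "0 < \<eta>" "\<eta> \<le> exp (- 1)"
    using p \<sigma> n small by (auto simp: \<eta>_def field_simps)
  have p_eq: "p / real n = \<eta> * \<sigma>" using \<sigma> n by (simp add: \<eta>_def)
  have cond: "real n powr (2 / s) * (p / real n)\<^sup>2 \<ge> \<sigma>\<^sup>2 * ln (real n) \<longleftrightarrow> N powr q * \<eta>\<^sup>2 \<ge> ln N"
    using \<sigma> by (simp add: p_eq q_def N_def power_mult_distrib mult_ac)
  show ?thesis
  proof (cases "N powr q * \<eta>\<^sup>2 \<ge> ln N")
    case False
    obtain J where J: "J \<subseteq> {1..n}" "card J = 0"
      "sq_bias n (\<lambda>i. \<theta> i / \<sigma>) J \<le> \<eta>\<^sup>2 * N powr q * (\<Sum>i\<in>{0<..n}. real i powr - q)"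
      using weak_ball_sq_bias_le[OF \<sigma> \<theta>, of 0] by (auto simp: \<eta>_def q_def N_def)
    \<comment> \<open>The tail bound needs a starting index of at least 1, so the first term, equal
      to 1, is split off.\<close>
    have "{0<..n} = insert 1 {1<..n}" using n by auto
    then have "(\<Sum>i\<in>{0<..n}. real i powr - q) \<le> 1 + s / (2 - s)"
      using sum_powr_tail_le[OF q, of 1 n] n q1 by simp
    also have "\<dots> \<le> rate_const s"
    proof -
      have "1 * 1 \<le> (1 + s powr - (s / 2)) * (1 + 3 * s / 2)"
        using s by (intro mult_mono) auto
      then show ?thesis by (simp add: rate_const_def)
    qed
    finally have tail: "(\<Sum>i\<in>{0<..n}. real i powr - q) \<le> rate_const s" .
    have "sq_bias n (\<lambda>i. \<theta> i / \<sigma>) J \<le> \<eta>\<^sup>2 * N powr q * rate_const s"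
      using J(3) mult_left_mono[OF tail, of "\<eta>\<^sup>2 * N powr q"] by simp
    also have "\<dots> \<le> (N powr q * \<eta>\<^sup>2 + 1) * rate_const s"
      using rate_const_pos[OF s] by (intro mult_right_mono) auto
    also have "\<dots> = rate_const s * weak_rate_sq s n \<sigma> p / \<sigma>\<^sup>2"
    proof -
      have "weak_rate_sq s n \<sigma> p = (N powr q * \<eta>\<^sup>2 + 1) * \<sigma>\<^sup>2"
        using False unfolding weak_rate_sq_def cond
        by (simp add: p_eq q_def N_def power_mult_distrib algebra_simps)
      then show ?thesis using \<sigma> by simp
    qed
    finally have "sq_bias n (\<lambda>i. \<theta> i / \<sigma>) J \<le> \<dots>" .
    moreover have "sparsity_cost n J = 0" using J(2) by (simp add: sparsity_cost_def)
    ultimately show ?thesis using J(1) by (intro that[of J]) auto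
  next
    case True
    define L where "L = ln (1 / \<eta>)"
    \<comment> \<open>\<open>ks\<close> solves \<open>\<eta>\<^sup>2 (N / ks) powr q = L\<close>: it balances the squared bias per coordinate and the cost.\<close>
    define ks where "ks = N * (\<eta> powr s * L powr - (s / 2))"
    define k where "k = nat \<lceil>ks\<rceil>"
    have "ln \<eta> \<le> ln (exp (- 1))" using \<eta> by (subst ln_le_cancel_iff) auto
    then have L: "L \<ge> 1" using \<eta> by (simp add: L_def ln_div)
    have ln\<eta>: "ln \<eta> = - L" using \<eta> by (simp add: L_def ln_div)
    have lnL: "0 \<le> ln L" "ln L \<le> L" using L ln_bound[of L] by auto
    have ks: "ks > 0" using N \<eta> L by (simp add: ks_def)
    have ln_ks: "ln ks = ln N - s * L - s / 2 * ln L"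
      using N \<eta> L by (simp add: ks_def ln_mult ln_powr ln\<eta>)
    have lnN: "ln N \<ge> 1"
    proof -
      have "exp 1 \<le> (3::real)" using exp_le by simp
      then have "ln (exp 1) \<le> ln N" using N by (subst ln_le_cancel_iff) auto
      then show ?thesis by simp
    qed
    \<comment> \<open>Taking logarithms in the regime condition bounds \<open>L\<close> by a
      multiple of \<open>ln N\<close>.\<close>
    have "0 \<le> ln (ln N)" using lnN by simp
    also have ln_cond: "ln (ln N) \<le> q * ln N - 2 * L"
    proof -
      have "ln (ln N) \<le> ln (N powr q * \<eta>\<^sup>2)"
        using True lnN N \<eta> by (subst ln_le_cancel_iff) auto
      also have "\<dots> = q * ln N - 2 * L"
        using N \<eta> by (simp add: ln_mult ln_powr ln_realpow ln\<eta>)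
      finally show ?thesis .
    qed
    finally have "s * (2 * L) \<le> s * (q * ln N)" using s by (intro mult_left_mono) auto
    then have sL: "s * L \<le> ln N" using s by (simp add: q_def)
    \<comment> \<open>Inserting \<open>s * L \<le> ln N\<close> into the logarithm of the regime
      condition keeps \<open>ks\<close> away from 0 by a constant depending on \<open>s\<close>
      only. Hence \<open>ks + 1\<close> is at most a constant times \<open>ks\<close>, and rounding
      up is harmless.\<close>
    have ks_lower: "s powr (s / 2) \<le> ks"
    proof -
      have "ln (s * L) \<le> ln (ln N)"
        using sL s L lnN by (subst ln_le_cancel_iff) auto
      then have "ln s + ln L \<le> q * ln N - 2 * L"
        using ln_cond s L by (simp add: ln_mult)
      then have "s / 2 * (ln s + ln L) \<le> s / 2 * (q * ln N - 2 * L)"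
        using s by (intro mult_left_mono) auto
      then have "s / 2 * ln s \<le> ln ks"
        using s by (simp add: ln_ks q_def algebra_simps add_divide_distrib)
      then have "exp (s / 2 * ln s) \<le> exp (ln ks)" by simp
      then show ?thesis using ks s by (simp add: powr_def)
    qed
    \<comment> \<open>Both factors in \<open>ks\<close> next to \<open>N\<close> are at most 1, so
      that \<open>k\<close> does not exceed \<open>n\<close>.\<close>
    have "\<eta> powr s \<le> 1 powr s"
      using \<eta> s by (intro powr_mono2) (auto intro: order.trans[OF \<eta>(2)])
    moreover have "L powr - (s / 2) \<le> 1 powr - (s / 2)"
      using L s by (intro powr_mono2') auto
    ultimately have "ks \<le> N * (1 * 1)"
      unfolding ks_def using N by (intro mult_left_mono mult_mono) auto
    then have kn: "k \<le> n" by (simp add: k_def N_def nat_le_iff ceiling_le_iff)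
    have k1: "k \<ge> 1" and kks: "ks \<le> real k" and kup: "real k \<le> ks + 1"
      using ks unfolding k_def by linarith+
    obtain J where J: "J \<subseteq> {1..n}" "card J = k"
      "sq_bias n (\<lambda>i. \<theta> i / \<sigma>) J \<le> \<eta>\<^sup>2 * N powr q * (\<Sum>i\<in>{k<..n}. real i powr - q)"
      using weak_ball_sq_bias_le[OF \<sigma> \<theta> kn] by (auto simp: \<eta>_def q_def N_def)
    have "sparsity_cost n J \<le> (ks + 1) * ((1 + 3 * s / 2) * L)"
      unfolding sparsity_cost_def J(2)
    proof (intro mult_mono kup)
      have "ln (exp 1 * real n / real k) \<le> ln (exp 1 * N / ks)"
        using ks k1 kks N unfolding N_def
        by (subst ln_le_cancel_iff) (auto intro!: divide_left_mono)
      also have "\<dots> = 1 + s * L + s / 2 * ln L"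
        using N ks by (simp add: ln_div ln_mult ln_ks)
      also have "\<dots> \<le> L + s * L + s / 2 * L"
        using L lnL s by (intro add_mono mult_left_mono) auto
      finally show "ln (exp 1 * real n / real k) \<le> (1 + 3 * s / 2) * L"
        by (simp add: algebra_simps)
      have "1 * real k \<le> exp 1 * real n"
        using kn by (intro mult_mono) auto
      then show "0 \<le> ln (exp 1 * real n / real k)"
        using k1 by (simp add: field_simps)
    qed (use ks in auto)
    also have "\<dots> \<le> (ks * (1 + s powr - (s / 2))) * ((1 + 3 * s / 2) * L)"
    proof (intro mult_right_mono)
      have "1 = s powr (s / 2) * s powr - (s / 2)" using s by (simp flip: powr_add)
      also have "\<dots> \<le> ks * s powr - (s / 2)" using ks_lower by (intro mult_right_mono) auto
      finally show "ks + 1 \<le> ks * (1 + s powr - (s / 2))" by (simp add: algebra_simps)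
    qed (use s L in auto)
    finally have cost: "sparsity_cost n J \<le> ((1 + s powr - (s / 2)) * (1 + 3 * s / 2)) * (ks * L)"
      by (simp add: mult_ac)
    have "(\<Sum>i\<in>{k<..n}. real i powr - q) \<le> real k powr (1 - q) / (q - 1)"
      by (rule sum_powr_tail_le[OF q k1 kn])
    also have "\<dots> \<le> ks powr (1 - q) / (q - 1)"
      using q ks kks by (intro divide_right_mono powr_mono2') auto
    finally have "\<eta>\<^sup>2 * N powr q * (\<Sum>i\<in>{k<..n}. real i powr - q)
        \<le> \<eta>\<^sup>2 * N powr q * (ks powr (1 - q) / (q - 1))"
      by (intro mult_left_mono) auto
    with J(3) have "sq_bias n (\<lambda>i. \<theta> i / \<sigma>) J \<le> \<eta>\<^sup>2 * N powr q * (ks powr (1 - q) / (q - 1))"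
      by (rule order.trans)
    also have "\<dots> = \<eta>\<^sup>2 * N powr q * ks powr (1 - q) * (1 / (q - 1))" by simp
    \<comment> \<open>This is the balance equation of \<open>ks\<close> multiplied by
      \<open>ks\<close>, checked on logarithms.\<close>
    also have "\<eta>\<^sup>2 * N powr q * ks powr (1 - q) = ks * L"
    proof -
      have "ln (\<eta>\<^sup>2 * N powr q * ks powr (1 - q)) = - 2 * L + q * ln N + (1 - q) * ln ks"
        using \<eta> N ks by (simp add: ln_mult ln_powr ln_realpow ln\<eta>)
      also have "\<dots> = ln ks + ln L"
        unfolding ln_ks q_def using s by (simp add: field_simps)
      also have "\<dots> = ln (ks * L)" using ks L by (simp add: ln_mult)
      finally show ?thesis using \<eta> N ks L by (subst (asm) ln_inj_iff) auto
    qed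
    finally have bias: "sq_bias n (\<lambda>i. \<theta> i / \<sigma>) J \<le> s / (2 - s) * (ks * L)"
      by (simp add: q1 mult.commute)
    have rate: "weak_rate_sq s n \<sigma> p = (ks * L) * \<sigma>\<^sup>2"
    proof -
      have "real n * \<sigma> / p = 1 / \<eta>" by (simp add: \<eta>_def)
      then have "weak_rate_sq s n \<sigma> p = N * (\<eta> * \<sigma>) powr s * (\<sigma>\<^sup>2 * L) powr (1 - s / 2)"
        using True unfolding weak_rate_sq_def cond by (simp add: p_eq N_def L_def)
      also have "\<dots> = N * \<eta> powr s * (\<sigma> powr s * \<sigma>\<^sup>2 powr (1 - s / 2)) * L powr (1 - s / 2)"
        using \<eta> \<sigma> L by (simp add: powr_mult mult_ac)
      also have "\<sigma> powr s * \<sigma>\<^sup>2 powr (1 - s / 2) = \<sigma>\<^sup>2"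
        using \<sigma> by (simp add: powr_powr powr_add[symmetric] flip: powr_numeral)
      also have "L powr (1 - s / 2) = L powr - (s / 2) * L"
        using L powr_add[of L "- (s / 2)" 1] by simp
      finally show ?thesis by (simp add: ks_def mult_ac)
    qed
    show ?thesis
    proof (rule that[OF J(1)])
      have "sparsity_cost n J + sq_bias n (\<lambda>i. \<theta> i / \<sigma>) J \<le> rate_const s * (ks * L)"
        using cost bias unfolding rate_const_def by (simp add: distrib_right)
      then show "sparsity_cost n J + sq_bias n (\<lambda>i. \<theta> i / \<sigma>) J \<le>
          rate_const s * weak_rate_sq s n \<sigma> p / \<sigma>\<^sup>2"
        using \<sigma> by (simp add: rate)
    qed
  qed
qed

section \<open>Constants and uniformity over the weak ball\<close>

theorem corollary2:
  fixes kind :: eb_kind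
  shows "\<exists>K :: real \<Rightarrow> real. (\<forall>s. 0 < s \<and> s < 2 \<longrightarrow> K s > 0) \<and>
    (\<forall>\<beta> B \<kappa> :: real.
      0 < \<beta> \<longrightarrow> \<beta> \<le> 1 \<longrightarrow> B > 0 \<longrightarrow> \<kappa> > 1 \<longrightarrow> \<kappa> > (12 - \<beta> + 4 * B) / (4 * \<beta>) \<longrightarrow>
      (\<exists>M0 H0 m0 M1 H1 m1 M0' H0' :: real.
        M0 > 0 \<and> H0 > 0 \<and> m0 > 0 \<and> M1 > 0 \<and> H1 > 0 \<and> m1 > 0 \<and> M0' > 0 \<and> H0' > 0 \<and>
        (\<forall>(s :: real) (\<sigma> :: nat \<Rightarrow> real) (p :: nat \<Rightarrow> real)
          (Q :: nat \<Rightarrow> (nat \<Rightarrow> real) \<Rightarrow> (nat \<Rightarrow> real) measure)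
          (Ihat :: nat \<Rightarrow> (nat \<Rightarrow> real) \<Rightarrow> nat set).
          0 < s \<longrightarrow> s < 2 \<longrightarrow>
          (\<forall>n\<ge>1. \<sigma> n > 0) \<longrightarrow> (\<forall>n\<ge>1. p n > 0) \<longrightarrow> p \<in> o(\<lambda>n. \<sigma> n * real n) \<longrightarrow>
          (\<forall>n\<ge>1. \<forall>\<theta>\<in>space (Rn n). noise_law n (Q n \<theta>) \<and> exch_exp_moment \<beta> B n (Q n \<theta>)) \<longrightarrow>
          (\<forall>n\<ge>1. max_selector \<kappa> n (\<sigma> n) (Ihat n)) \<longrightarrow>
          (\<forall>\<^sub>F n in sequentially. \<forall>M\<ge>0.
            (SUP \<theta>\<in>weak_ball s n (p n).
               \<integral>\<^sup>+x. emeasure (eb_posterior kind \<kappa> n (\<sigma> n) (Ihat n) x)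
                      {\<eta> \<in> space (Rn n).
                        sq_dist n \<eta> \<theta> \<ge> M0 * K s * weak_rate_sq s n (\<sigma> n) (p n) + M * (\<sigma> n)\<^sup>2}
                  \<partial>obs_law n (\<sigma> n) (Q n \<theta>) \<theta>)
              \<le> ennreal (H0 * exp (- m0 * M)) \<and>
            (SUP \<theta>\<in>weak_ball s n (p n).
               emeasure (obs_law n (\<sigma> n) (Q n \<theta>) \<theta>)
                 {x \<in> space (Rn n).
                   sq_dist n (eb_estimator kind \<kappa> n (\<sigma> n) (Ihat n) x) \<theta>
                     \<ge> M1 * K s * weak_rate_sq s n (\<sigma> n) (p n) + M * (\<sigma> n)\<^sup>2})
              \<le> ennreal (H1 * exp (- m1 * M)) \<and>
            (SUP \<theta>\<in>weak_ball s n (p n).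
               emeasure (obs_law n (\<sigma> n) (Q n \<theta>) \<theta>)
                 {x \<in> space (Rn n).
                   eb_radius_sq n (\<sigma> n) (Ihat n x)
                     \<ge> M0' * K s * weak_rate_sq s n (\<sigma> n) (p n) + (M + 1) * (\<sigma> n)\<^sup>2})
              \<le> ennreal (H0' * exp (- M))))))"
proof (rule exI[of _ rate_const], intro conjI allI impI, goal_cases)
  case (1 s)
  then show ?case by (simp add: rate_const_pos)
next
  case (2 \<beta> B \<kappa>)
  note \<beta> = 2(1,2) and B = 2(3) and \<kappa> = 2(4)
  define g where "g = \<beta> * (\<kappa> + 1 / 4)"
  define a where "a = \<beta> / (8 * (\<kappa> + 1 / 2))"
  define D where "D = g + 2 + B"
  \<comment> \<open>A rearrangement of the lower bound on \<open>\<kappa>\<close>: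
    \<open>(12 - \<beta> + 4 B) / (4 \<beta>) = (3 + B) / \<beta> - 1/4\<close>.\<close>
  have g: "3 + B \<le> g" using 2(5) \<beta> by (simp add: g_def field_simps)
  have a: "a > 0" using \<beta> \<kappa> by (simp add: a_def)
  have D: "D > 0" using g B by (simp add: D_def)
  show ?case
  \<comment> \<open>The bounds have exponents \<open>D * R - a * T / \<sigma>^2\<close> and
    \<open>D * R - (T / \<sigma>^2 - 1)\<close>; the factors \<open>D / a\<close> and
    \<open>D\<close> of the rate in \<open>T\<close> make \<open>D * R\<close> cancel. All witnesses
    are built from \<open>\<beta>\<close>, \<open>B\<close> and \<open>\<kappa>\<close>
    alone.\<close>
  proof (rule exI[of _ "D / a"], rule exI[of _ 2], rule exI[of _ a], rule exI[of _ "D / a"],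
      rule exI[of _ 2], rule exI[of _ a], rule exI[of _ D], rule exI[of _ 2],
      intro conjI allI impI, goal_cases)
    case (9 s \<sigma> p Q Ihat)
    note s = 9(1,2) and \<sigma> = 9(3) and p = 9(4) and small = 9(5) and Q = 9(6) and sel = 9(7)
    \<comment> \<open>The ratio \<open>p / (\<sigma> n)\<close> below \<open>exp (- 1)\<close> gives
      \<open>L \<ge> 1\<close>, and \<open>n \<ge> 3\<close> gives
      \<open>ln n \<ge> 1\<close>.\<close>
    from landau_o.smallD[OF small exp_gt_zero, of "- 1"] eventually_ge_at_top[of 3] show ?case
    proof eventually_elim
      case (elim n)
      have pos: "\<sigma> n > 0" "p n > 0" and sel_n: "max_selector \<kappa> n (\<sigma> n) (Ihat n)"
        using \<sigma> p sel elim by auto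
      then have small_n: "p n \<le> exp (- 1) * (\<sigma> n * real n)" using elim by simp
      define R where "R = rate_const s * weak_rate_sq s n (\<sigma> n) (p n) / (\<sigma> n)\<^sup>2"
      have bounds: "(\<integral>\<^sup>+x. emeasure (eb_posterior kind \<kappa> n (\<sigma> n) (Ihat n) x)
             {\<eta> \<in> space (Rn n). sq_dist n \<eta> \<theta> \<ge> T} \<partial>obs_law n (\<sigma> n) (Q n \<theta>) \<theta>)
           \<le> ennreal (2 * exp (D * R - a * T / (\<sigma> n)\<^sup>2))" (is ?post)
        "emeasure (obs_law n (\<sigma> n) (Q n \<theta>) \<theta>)
            {x \<in> space (Rn n). sq_dist n (eb_estimator kind \<kappa> n (\<sigma> n) (Ihat n) x) \<theta> \<ge> T}
           \<le> ennreal (2 * exp (D * R - a * T / (\<sigma> n)\<^sup>2))" (is ?est)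
        "emeasure (obs_law n (\<sigma> n) (Q n \<theta>) \<theta>) {x \<in> space (Rn n). eb_radius_sq n (\<sigma> n) (Ihat n x) \<ge> T}
           \<le> ennreal (2 * exp (D * R - (T / (\<sigma> n)\<^sup>2 - 1)))" (is ?rad)
        if \<theta>: "\<theta> \<in> weak_ball s n (p n)" for \<theta> T
      proof -
        obtain J where J: "J \<subseteq> {1..n}" "sparsity_cost n J + sq_bias n (\<lambda>i. \<theta> i / \<sigma> n) J \<le> R"
          using weak_ball_oracle_le[OF s pos elim(2) small_n \<theta>] unfolding R_def .
        have "\<theta> \<in> space (Rn n)" using \<theta> by (simp add: weak_ball_def)
        then have "sets (Q n \<theta>) = sets (Rn n)" "exch_exp_moment \<beta> B n (Q n \<theta>)"
          using Q elim(2) by (auto simp: noise_law_def)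
        note eb = pos(1) sel_n this J(1) \<beta> \<kappa> B g_def g a_def J(2)
        show ?post unfolding D_def by (rule eb_posterior_bound[OF eb])
        show ?est unfolding D_def by (rule eb_estimator_bound[OF eb])
        show ?rad unfolding D_def by (rule eb_radius_bound[OF eb])
      qed
      have thresholds:
        "D * R - a * (D / a * rate_const s * weak_rate_sq s n (\<sigma> n) (p n) + M * (\<sigma> n)\<^sup>2) / (\<sigma> n)\<^sup>2 = - a * M"
        "D * R - ((D * rate_const s * weak_rate_sq s n (\<sigma> n) (p n) + (M + 1) * (\<sigma> n)\<^sup>2) / (\<sigma> n)\<^sup>2 - 1) = - M" for M
        using pos a by (simp_all add: R_def add_divide_distrib distrib_left)
      show ?case
      proof (intro allI impI conjI SUP_least)
        fix M :: real and \<theta> assume \<theta>: "\<theta> \<in> weak_ball s n (p n)"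
        let ?T = "D / a * rate_const s * weak_rate_sq s n (\<sigma> n) (p n) + M * (\<sigma> n)\<^sup>2"
        show "(\<integral>\<^sup>+x. emeasure (eb_posterior kind \<kappa> n (\<sigma> n) (Ihat n) x)
             {\<eta> \<in> space (Rn n). sq_dist n \<eta> \<theta> \<ge> ?T} \<partial>obs_law n (\<sigma> n) (Q n \<theta>) \<theta>)
           \<le> ennreal (2 * exp (- a * M))"
          using bounds(1)[OF \<theta>, of ?T] unfolding thresholds .
        show "emeasure (obs_law n (\<sigma> n) (Q n \<theta>) \<theta>)
            {x \<in> space (Rn n). sq_dist n (eb_estimator kind \<kappa> n (\<sigma> n) (Ihat n) x) \<theta> \<ge> ?T}
           \<le> ennreal (2 * exp (- a * M))"
          using bounds(2)[OF \<theta>, of ?T] unfolding thresholds .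
        let ?T = "D * rate_const s * weak_rate_sq s n (\<sigma> n) (p n) + (M + 1) * (\<sigma> n)\<^sup>2"
        show "emeasure (obs_law n (\<sigma> n) (Q n \<theta>) \<theta>) {x \<in> space (Rn n). eb_radius_sq n (\<sigma> n) (Ihat n x) \<ge> ?T}
           \<le> ennreal (2 * exp (- M))"
          using bounds(3)[OF \<theta>, of ?T] unfolding thresholds .
      qed
    qed
  qed (use a D in simp_all)
qed

end
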